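(* For $p>1$ and a (complex-valued) harmonic function $f\in h^p$ on the unit disk $\mathbb{D}$ we have the isoperimetric type inequality $$\|f\|_{B^{2p}}\le C_p\|f\|_p,\qquad\text{where}\qquad C_p=\frac{\sqrt2\,\cos\frac{\pi}{4p}}{\left(1-\left|\cos\frac{\pi}{p}\right|\right)^{1/2}}.$$
   Context: $\mathbb{D}$ is the open unit disk in $\mathbb{C}$. For harmonic $f:\mathbb{D}\to\mathbb{C}$, $\|f\|_p=\sup_{0<r<1}\left(\frac1{2\pi}\int_0^{2\pi}|f(re^{i\theta})|^p d\theta\right)^{1/p}$, and $f\in h^p$ means $\|f\|_p<\infty$. $B^{2p}$ is the Bergman space of harmonic mappings on $\mathbb{D}$ belonging to the Lebesgue space $L^{2p}(\mathbb{D})$, with $\|f\|_{B^{2p}}=\left(\int_{\mathbb{D}}|f(z)|^{2p}\frac{dx\,dy}{\pi}\right)^{1/(2p)}$, $z=x+iy$. *)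

theory Defs
  imports "HOL-Analysis.Analysis"
begin

definition partial_deriv :: "'a \<Rightarrow> ('a::euclidean_space \<Rightarrow> 'b::real_normed_vector) \<Rightarrow> 'a \<Rightarrow> 'b" where
  "partial_deriv b f z = vector_derivative (\<lambda>t::real. f (z + t *\<^sub>R b)) (at 0)"

definition C1_on :: "'a set \<Rightarrow> ('a::euclidean_space \<Rightarrow> 'b::real_normed_vector) \<Rightarrow> bool" where
  "C1_on S f \<longleftrightarrow>
    (\<forall>b\<in>Basis. (\<forall>z\<in>S. (\<lambda>t::real. f (z + t *\<^sub>R b)) differentiable (at 0)) \<and>
               continuous_on S (partial_deriv b f))"

definition C2_on :: "'a set \<Rightarrow> ('a::euclidean_space \<Rightarrow> 'b::real_normed_vector) \<Rightarrow> bool" where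
  "C2_on S f \<longleftrightarrow> C1_on S f \<and> (\<forall>b\<in>Basis. C1_on S (partial_deriv b f))"

definition laplacian :: "('a::euclidean_space \<Rightarrow> 'b::real_normed_vector) \<Rightarrow> 'a \<Rightarrow> 'b" where
  "laplacian f z = (\<Sum>b\<in>Basis. partial_deriv b (partial_deriv b f) z)"

lemma laplacian_complex:
  fixes f :: "complex \<Rightarrow> 'b::real_normed_vector"
  shows "laplacian f z =
    partial_deriv 1 (partial_deriv 1 f) z + partial_deriv \<i> (partial_deriv \<i> f) z"
  by (simp add: laplacian_def Basis_complex_def)

definition harmonic_on :: "('a::euclidean_space \<Rightarrow> 'b::real_normed_vector) \<Rightarrow> 'a set \<Rightarrow> bool" where
  "harmonic_on f S \<longleftrightarrow> open S \<and> C2_on S f \<and> (\<forall>z\<in>S. laplacian f z = 0)"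

definition circle_mean :: "real \<Rightarrow> (complex \<Rightarrow> complex) \<Rightarrow> real \<Rightarrow> real" where
  "circle_mean p f r =
    (1 / (2 * pi) * (LBINT \<theta>:{0..2 * pi}. norm (f (of_real r * exp (\<i> * of_real \<theta>))) powr p))
      powr (1 / p)"

text \<open>Both norms below are real-valued, so they are meaningful only on the corresponding
  space, whose definition carries the finiteness condition.\<close>

definition hardy_norm :: "real \<Rightarrow> (complex \<Rightarrow> complex) \<Rightarrow> real" where
  "hardy_norm p f = (SUP r\<in>{0<..<1}. circle_mean p f r)"

definition harmonic_hardy :: "real \<Rightarrow> (complex \<Rightarrow> complex) set" where
  "harmonic_hardy p = {f. harmonic_on f (ball 0 1) \<and> bdd_above (circle_mean p f ` {0<..<1})}"

definition bergman_norm :: "real \<Rightarrow> (complex \<Rightarrow> complex) \<Rightarrow> real" where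
  "bergman_norm q f = ((LBINT z:ball 0 1. norm (f z) powr q) / pi) powr (1 / q)"

text \<open>Functions harmonic on the disk are continuous there, so membership in the Lebesgue space
  reduces to integrability of the power of the modulus.\<close>

definition harmonic_bergman :: "real \<Rightarrow> (complex \<Rightarrow> complex) set" where
  "harmonic_bergman q =
    {f. harmonic_on f (ball 0 1) \<and> set_integrable lborel (ball 0 1) (\<lambda>z. norm (f z) powr q)}"

end

theory Submission
  imports Defs "HOL-Complex_Analysis.Complex_Analysis"
begin

text \<open>
The modulus of a harmonic function on the disk is dominated by the Poisson integral of the modulus
of its boundary values, so it suffices to treat Poisson integrals \<open>u\<close> of positive continuous
functions \<open>F\<close>.  This is a decisive gain: \<open>u = Re g\<close>, where the Herglotz integral \<open>g\<close> of \<open>F\<close> takes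
values in the right half plane, so that all real powers of \<open>g\<close> are holomorphic and only inequalities
about one angle between \<open>- pi / 2\<close> and \<open>pi / 2\<close> are needed.

For \<open>1 < p \<le> 2\<close> the constant equals \<open>cos (pi / (4 * p)) / cos (pi / (2 * p))\<close>, and three estimates
combine.  The inequality \<open>Re_powr_ge_right_half_plane\<close>, averaged over circles, bounds the means of
\<open>norm g powr p\<close> by those of \<open>u powr p\<close>; this costs the factor \<open>1 / cos (pi / (2 * p))\<close>.  Carleman's
inequality, which is Cauchy-Schwarz for the power series coefficients of \<open>g powr (p / 2)\<close>, bounds the
area integral of \<open>norm g powr (2 * p)\<close> by the square of these means.  Finally
\<open>Re_powr_le_right_half_plane\<close> with exponent \<open>2 * p\<close> brings in the factor \<open>cos (pi / (4 * p))\<close>.  The two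
pointwise inequalities contain the terms \<open>Re (g powr p)\<close> and \<open>Re (g powr (2 * p))\<close>, whose means are
powers of the positive number \<open>g 0\<close>.  The first of these helps and the second hurts, and
\<open>tangent_slope_double_le\<close> says that the gain outweighs the loss.

For \<open>p > 2\<close> Jensen's inequality for the Poisson kernel reduces the claim to \<open>p = 2\<close>, because the
constant is at least 1 at 2 and increases beyond.

To get there, a function with continuous second partial derivatives and vanishing Laplacian is
written as a holomorphic function plus the conjugate of one, which gives the Poisson formula on
smaller circles.  The given function itself need not extend to the unit circle:
all estimates are proved for its dilations, and Fatou's lemma lets the radius tend to 1.
\<close>

section \<open>Trigonometric inequalities and powers in the right half plane\<close>

text \<open>
Here \<open>m\<close> carries the sign of the slope of \<open>h\<close> and \<open>k\<close> the sign of the slope of \<open>m\<close>.  As \<open>k\<close>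
decreases, \<open>m\<close> rises and then falls, so between its two zeros \<open>m\<close> is nonnegative and beyond the
second one nonpositive: \<open>h\<close> climbs up to that zero and descends afterwards.
\<close>

lemma le_value_at_second_zero_of_slope:
  fixes h m k P Q :: "real \<Rightarrow> real"
  assumes \<alpha>: "0 < \<alpha>" "\<alpha> < b" and x: "0 \<le> x" "x < b"
    and h: "\<And>y. 0 \<le> y \<Longrightarrow> y < b \<Longrightarrow> (h has_real_derivative P y * m y) (at y)"
    and m: "\<And>y. 0 \<le> y \<Longrightarrow> y < b \<Longrightarrow> (m has_real_derivative Q y * k y) (at y)"
    and pos: "\<And>y. 0 \<le> y \<Longrightarrow> y < b \<Longrightarrow> 0 < P y" "\<And>y. 0 \<le> y \<Longrightarrow> y < b \<Longrightarrow> 0 < Q y"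
    and k: "\<And>y z. 0 \<le> y \<Longrightarrow> y \<le> z \<Longrightarrow> z < b \<Longrightarrow> k z \<le> k y"
    and m0: "m 0 = 0" "m \<alpha> = 0"
  shows "h x \<le> h \<alpha>"
proof -
  have mvt: "\<exists>z>u. z < v \<and> m v - m u = (v - u) * (Q z * k z)" if "0 \<le> u" "u < v" "v < b" for u v
    using MVT2[of u v m "\<lambda>z. Q z * k z"] m that by auto
  have before: "m y \<ge> 0" if y: "0 \<le> y" "y \<le> \<alpha>" for y
  proof (rule ccontr)
    assume neg: "\<not> m y \<ge> 0"
    then have "y \<noteq> 0" "y \<noteq> \<alpha>" using m0 by auto
    then have yy: "0 < y" "y < \<alpha>" using y by auto
    obtain z where z: "0 < z" "z < y" "m y - m 0 = (y - 0) * (Q z * k z)"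
      using mvt[of 0 y] yy \<alpha> by auto
    have "y * (Q z * k z) < 0" using z neg m0 by auto
    then have "k z < 0" using pos(2)[of z] z yy \<alpha> by (auto simp: mult_less_0_iff)
    obtain w where w: "y < w" "w < \<alpha>" "m \<alpha> - m y = (\<alpha> - y) * (Q w * k w)"
      using mvt[of y \<alpha>] yy \<alpha> by auto
    have "(\<alpha> - y) * (Q w * k w) > 0" using w neg m0 by auto
    then have "k w > 0" using pos(2)[of w] w yy \<alpha> by (auto simp: zero_less_mult_iff)
    then show False using k[of z w] z w \<alpha> \<open>k z < 0\<close> by auto
  qed
  have after: "m y \<le> 0" if y: "\<alpha> \<le> y" "y < b" for y
  proof (rule ccontr)
    assume neg: "\<not> m y \<le> 0"
    then have yy: "\<alpha> < y" using y m0 by (cases "y = \<alpha>") auto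
    obtain w where w: "\<alpha> < w" "w < y" "m y - m \<alpha> = (y - \<alpha>) * (Q w * k w)"
      using mvt[of \<alpha> y] yy y \<alpha> by auto
    have "(y - \<alpha>) * (Q w * k w) > 0" using w neg m0 by auto
    then have kw: "k w > 0" using pos(2)[of w] w yy y \<alpha> by (auto simp: zero_less_mult_iff)
    obtain z where z: "0 < z" "z < \<alpha>" "m \<alpha> - m 0 = (\<alpha> - 0) * (Q z * k z)"
      using mvt[of 0 \<alpha>] \<alpha> by auto
    then have "k z = 0" using pos(2)[of z] m0 \<alpha> by auto
    then show False using k[of z w] z w y kw by auto
  qed
  show ?thesis
  proof (cases "x \<le> \<alpha>")
    case True
    show ?thesis
    proof (rule DERIV_nonneg_imp_nondecreasing[OF True])
      fix y assume y: "x \<le> y" "y \<le> \<alpha>"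
      then show "\<exists>d. (h has_real_derivative d) (at y) \<and> d \<ge> 0"
        using h[of y] before[of y] pos(1)[of y] x \<alpha>
        by (intro exI[of _ "P y * m y"]) (auto intro!: mult_nonneg_nonneg less_imp_le)
    qed
  next
    case False
    then have "\<alpha> \<le> x" by simp
    then show ?thesis
    proof (rule DERIV_nonpos_imp_nonincreasing)
      fix y assume y: "\<alpha> \<le> y" "y \<le> x"
      then show "\<exists>d. (h has_real_derivative d) (at y) \<and> d \<le> 0"
        using h[of y] after[of y] pos(1)[of y] x \<alpha>
        by (intro exI[of _ "P y * m y"] conjI mult_nonneg_nonpos) auto
    qed
  qed
qed

text \<open>
The number \<open>B\<close> for which \<open>cos x powr q - B * cos (q * x)\<close> has a critical point at
\<open>x = pi / (2 * q)\<close>, the first zero of \<open>cos (q * x)\<close>.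
\<close>

definition tangent_slope :: "real \<Rightarrow> real" where
  "tangent_slope q = cos (pi / (2 * q)) powr (q - 1) * sin (pi / (2 * q))"

lemma tangency_angle:
  assumes "(1::real) < q"
  shows "0 < pi / (2 * q)" "pi / (2 * q) < pi / 2" "0 < cos (pi / (2 * q))" "0 < sin (pi / (2 * q))"
proof -
  show 1: "0 < pi / (2 * q)" "pi / (2 * q) < pi / 2" using assms by (auto simp: field_simps)
  show "0 < cos (pi / (2 * q))" using 1 by (intro cos_gt_zero) auto
  show "0 < sin (pi / (2 * q))" using 1 by (intro sin_gt_zero) auto
qed

text \<open>
Up to positive factors, the slope of \<open>cos x powr q - B * cos (q * x)\<close> is
\<open>m x = B * sin (q * x) / cos x powr q - tan x\<close>, and the slope of \<open>m\<close> is \<open>B * q * w x - 1\<close> with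
\<open>w x = cos ((q - 1) * x) / cos x powr (q - 1)\<close>.  The derivative of \<open>w\<close> has the sign of
\<open>- sin ((q - 2) * x)\<close>, so \<open>w\<close> decreases for \<open>q \<ge> 2\<close> and increases for \<open>q \<le> 2\<close>; the sign \<open>\<sigma>\<close>
treats both cases at once.  The bound \<open>q \<le> 4\<close> keeps \<open>(q - 2) * x\<close> below \<open>pi\<close>.
\<close>

lemma cos_powr_extremum:
  fixes q :: real
  assumes q: "1 < q" "q \<le> 4" and x: "0 \<le> x" "x < pi / 2"
    and \<sigma>: "\<sigma> = 1 \<and> 2 \<le> q \<or> \<sigma> = -1 \<and> q \<le> 2"
  shows "\<sigma> * (cos x powr q - tangent_slope q * cos (q * x)) \<le> \<sigma> * cos (pi / (2 * q)) powr q"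
proof -
  define \<alpha> where "\<alpha> = pi / (2 * q)"
  define B where "B = tangent_slope q"
  note \<alpha> = tangency_angle[OF q(1), folded \<alpha>_def]
  have q\<alpha>: "q * \<alpha> = pi / 2" using q by (simp add: \<alpha>_def)
  have B: "B = cos \<alpha> powr (q - 1) * sin \<alpha>" by (simp add: B_def tangent_slope_def \<alpha>_def)
  have Bpos: "B > 0" using \<alpha> by (simp add: B)
  have cpos: "0 < cos y" if "0 \<le> y" "y < pi / 2" for y using that by (intro cos_gt_zero_pi) auto
  define m where "m = (\<lambda>y. B * sin (q * y) / cos y powr q - tan y)"
  define w where "w = (\<lambda>y. cos ((q - 1) * y) / cos y powr (q - 1))"
  have h: "((\<lambda>x. \<sigma> * (cos x powr q - B * cos (q * x))) has_real_derivative
      (q * cos y powr q) * (\<sigma> * m y)) (at y)" if "0 \<le> y" "y < pi / 2" for y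
  proof -
    have eq: "sin y * cos y powr (q - 1) = tan y * cos y powr q"
      using cpos[OF that] by (simp add: tan_def powr_diff)
    have "((\<lambda>x. \<sigma> * (cos x powr q - B * cos (q * x))) has_real_derivative
        \<sigma> * (q * cos y powr (q - 1) * (- sin y) + B * (q * sin (q * y)))) (at y)"
      using cpos[OF that]
      by (auto intro!: derivative_eq_intros simp: powr_diff field_simps)
    moreover have "\<sigma> * (q * cos y powr (q - 1) * (- sin y) + B * (q * sin (q * y)))
        = (q * cos y powr q) * (\<sigma> * m y)"
      using cpos[OF that] unfolding m_def
      by (simp add: algebra_simps eq)
    ultimately show ?thesis by (simp only:)
  qed
  have mder: "(m has_real_derivative (1 / (cos y)\<^sup>2) * (B * q * w y - 1)) (at y)"
    if "0 \<le> y" "y < pi / 2" for y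
  proof -
    note c = cpos[OF that]
    have e: "cos ((q - 1) * y) = cos (q * y) * cos y + sin (q * y) * sin y"
      using cos_diff[of "q * y" y] by (simp add: algebra_simps)
    have "(m has_real_derivative ((B * (cos (q * y) * q)) * cos y powr q
         - B * sin (q * y) * (q * cos y powr (q - 1) * (- sin y))) / (cos y powr q * cos y powr q)
         - inverse ((cos y)\<^sup>2)) (at y)"
      unfolding m_def using c
      by (auto intro!: derivative_eq_intros simp: powr_diff field_simps)
    moreover have "((B * (cos (q * y) * q)) * cos y powr q
         - B * sin (q * y) * (q * cos y powr (q - 1) * (- sin y))) / (cos y powr q * cos y powr q)
         = B * q * w y / (cos y)\<^sup>2"
      using c unfolding w_def e by (simp add: powr_diff field_simps power2_eq_square)
    ultimately have "(m has_real_derivative B * q * w y / (cos y)\<^sup>2 - inverse ((cos y)\<^sup>2)) (at y)"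
      by (simp only:)
    then show ?thesis by (simp add: diff_divide_distrib inverse_eq_divide)
  qed
  have wder: "(w has_real_derivative (- (q - 1) * sin ((q - 2) * y) / cos y powr q)) (at y)"
    if "0 \<le> y" "y < pi / 2" for y
  proof -
    note c = cpos[OF that]
    have e: "sin ((q - 2) * y) = sin ((q - 1) * y) * cos y - cos ((q - 1) * y) * sin y"
      using sin_diff[of "(q-1) * y" y] by (simp add: algebra_simps)
    have "(w has_real_derivative ((- sin ((q - 1) * y) * (q - 1)) * cos y powr (q - 1)
         - cos ((q - 1) * y) * ((q - 1) * cos y powr (q - 2) * (- sin y)))
           / (cos y powr (q - 1) * cos y powr (q - 1))) (at y)"
      unfolding w_def
    proof (rule DERIV_divide)
      show "((\<lambda>y. cos ((q - 1) * y)) has_real_derivative - sin ((q - 1) * y) * (q - 1)) (at y)"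
        by (auto intro!: derivative_eq_intros)
      show "((\<lambda>y. cos y powr (q - 1)) has_real_derivative
          (q - 1) * cos y powr (q - 2) * (- sin y)) (at y)"
        using DERIV_fun_powr[OF DERIV_cos c, of "q - 1"] by simp
    qed (use c in simp)
    moreover have "((- sin ((q - 1) * y) * (q - 1)) * cos y powr (q - 1)
         - cos ((q - 1) * y) * ((q - 1) * cos y powr (q - 2) * (- sin y)))
           / (cos y powr (q - 1) * cos y powr (q - 1)) = - (q - 1) * sin ((q - 2) * y) / cos y powr q"
      using c unfolding e by (simp add: powr_diff field_simps power2_eq_square)
    ultimately show ?thesis by (simp only:)
  qed
  have mono: "\<sigma> * w z \<le> \<sigma> * w y" if yz: "0 \<le> y" "y \<le> z" "z < pi / 2" for y z
  proof (rule DERIV_nonpos_imp_nonincreasing[OF yz(2)])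
    fix t assume t: "y \<le> t" "t \<le> z"
    have "0 \<le> \<sigma> * sin ((q - 2) * t)"
    proof (cases "\<sigma> = 1")
      case True
      then have "2 \<le> q" using \<sigma> by auto
      have "(q - 2) * t \<le> 2 * t" using q t yz by (intro mult_right_mono) auto
      then have "sin ((q - 2) * t) \<ge> 0" using \<open>2 \<le> q\<close> t yz by (intro sin_ge_zero) auto
      then show ?thesis using True by simp
    next
      case False
      then have s: "\<sigma> = -1" "q \<le> 2" using \<sigma> by auto
      have "(2 - q) * t \<le> 1 * t" using q t yz by (intro mult_right_mono) auto
      then have "sin ((2 - q) * t) \<ge> 0" using s t yz by (intro sin_ge_zero) auto
      moreover have "sin ((q - 2) * t) = - sin ((2 - q) * t)"
        by (metis minus_diff_eq mult_minus_left sin_minus)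
      ultimately show ?thesis using s by simp
    qed
    then have "\<sigma> * (- (q - 1) * sin ((q - 2) * t) / cos t powr q) \<le> 0"
    proof -
      assume s: "0 \<le> \<sigma> * sin ((q - 2) * t)"
      have "\<sigma> * (- (q - 1) * sin ((q - 2) * t) / cos t powr q)
          = - ((q - 1) * (\<sigma> * sin ((q - 2) * t)) / cos t powr q)"
        unfolding minus_divide_left by (simp add: algebra_simps)
      also have "\<dots> \<le> 0" using s q by (auto intro!: divide_nonneg_nonneg mult_nonneg_nonneg)
      finally show ?thesis .
    qed
    moreover have "((\<lambda>t. \<sigma> * w t) has_real_derivative
        \<sigma> * (- (q - 1) * sin ((q - 2) * t) / cos t powr q)) (at t)"
      using wder[of t] t yz by (intro DERIV_cmult) auto
    ultimately show "\<exists>d. ((\<lambda>t. \<sigma> * w t) has_real_derivative d) (at t) \<and> d \<le> 0" by blast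
  qed
  have "\<sigma> * (cos x powr q - B * cos (q * x)) \<le> \<sigma> * (cos \<alpha> powr q - B * cos (q * \<alpha>))"
  proof (rule le_value_at_second_zero_of_slope[where b = "pi/2" and P = "\<lambda>y. q * cos y powr q"
        and m = "\<lambda>y. \<sigma> * m y" and Q = "\<lambda>y. 1 / (cos y)\<^sup>2" and k = "\<lambda>y. \<sigma> * (B * q * w y - 1)"
        and h = "\<lambda>x. \<sigma> * (cos x powr q - B * cos (q * x))"])
    show "((\<lambda>y. \<sigma> * m y) has_real_derivative 1 / (cos y)\<^sup>2 * (\<sigma> * (B * q * w y - 1))) (at y)"
      if "0 \<le> y" "y < pi / 2" for y
      using DERIV_cmult[OF mder[OF that], of \<sigma>] by (simp add: mult_ac)
    show "\<sigma> * (B * q * w z - 1) \<le> \<sigma> * (B * q * w y - 1)" if yz: "0 \<le> y" "y \<le> z" "z < pi / 2" for y z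
    proof -
      have "(B * q) * (\<sigma> * w z) \<le> (B * q) * (\<sigma> * w y)"
        by (intro mult_left_mono mono yz) (use Bpos q in auto)
      then show ?thesis by (simp add: algebra_simps)
    qed
    show "\<sigma> * m 0 = 0" by (simp add: m_def)
    show "\<sigma> * m \<alpha> = 0"
      using \<alpha> by (simp add: m_def B q\<alpha> tan_def powr_diff)
  qed (use \<alpha> x h cpos q in \<open>auto dest!: cpos\<close>)
  then show ?thesis by (simp add: B_def[symmetric] q\<alpha> \<alpha>_def[symmetric])
qed

lemma cos_powr_ge:
  assumes "1 < p" "p \<le> 2" "\<bar>x\<bar> < pi / 2"
  shows "cos (pi / (2 * p)) powr p + tangent_slope p * cos (p * x) \<le> cos x powr p"
  using cos_powr_extremum[of p "\<bar>x\<bar>" "-1"] assms by (cases "x \<ge> 0") auto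

lemma cos_powr_le:
  assumes "2 \<le> q" "q \<le> 4" "\<bar>x\<bar> < pi / 2"
  shows "cos x powr q \<le> cos (pi / (2 * q)) powr q + tangent_slope q * cos (q * x)"
  using cos_powr_extremum[of q "\<bar>x\<bar>" "1"] assms by (cases "x \<ge> 0") auto

text \<open>
In the right half plane the principal power multiplies the argument by the exponent, which turns
the trigonometric inequalities into inequalities between \<open>Re w\<close>, \<open>norm w\<close> and the real part of a
holomorphic function of \<open>w\<close>.
\<close>

lemma right_half_plane_powr:
  fixes w :: complex and q :: real
  assumes "Re w > 0"
  shows "norm (w powr of_real q) = norm w powr q"
    and "Re (w powr of_real q) = norm w powr q * cos (q * Arg w)"
    and "Re w = norm w * cos (Arg w)" and "\<bar>Arg w\<bar> < pi / 2"
proof -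
  have w: "w \<noteq> 0" using assms by auto
  show "norm (w powr of_real q) = norm w powr q"
    using w by (simp add: norm_powr_real_powr' powr_def)
  have "w powr of_real q = exp (of_real q * Ln w)" using w by (simp add: powr_def)
  then show "Re (w powr of_real q) = norm w powr q * cos (q * Arg w)"
    using w by (simp add: Re_exp powr_def Arg_def)
  show "Re w = norm w * cos (Arg w)"
    by (metis Re_rcis rcis_cmod_Arg)
  show "\<bar>Arg w\<bar> < pi / 2" using assms Arg_Re_pos by blast
qed

text \<open>
The pointwise form of the M. Riesz theorem on conjugate functions for exponents up to 2: averaged
over a circle, the last term on the left is known by the mean value property.
\<close>

lemma Re_powr_ge_right_half_plane:
  fixes w :: complex
  assumes "1 < p" "p \<le> 2" "Re w > 0"
  shows "cos (pi / (2 * p)) powr p * norm w powr p + tangent_slope p * Re (w powr of_real p)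
     \<le> Re w powr p"
proof -
  note W = right_half_plane_powr[OF assms(3)]
  have c: "cos (Arg w) > 0" using W(4) by (intro cos_gt_zero_pi) auto
  have "norm w powr p * (cos (pi / (2 * p)) powr p + tangent_slope p * cos (p * Arg w))
     \<le> norm w powr p * cos (Arg w) powr p"
    using cos_powr_ge[OF assms(1,2) W(4)] by (intro mult_left_mono) auto
  also have "\<dots> = Re w powr p" by (subst W(3)) (use c in \<open>simp add: powr_mult\<close>)
  finally show ?thesis by (simp add: W(2) algebra_simps)
qed

text \<open>
The companion of the previous estimate for exponents from 2 to 4, with the inequality reversed.  It
supplies the factor \<open>cos (pi / (4 * p))\<close> when it is used with \<open>q = 2 * p\<close>.
\<close>

lemma Re_powr_le_right_half_plane:
  fixes w :: complex
  assumes "2 \<le> q" "q \<le> 4" "Re w > 0"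
  shows "Re w powr q \<le>
     cos (pi / (2 * q)) powr q * norm w powr q + tangent_slope q * Re (w powr of_real q)"
proof -
  note W = right_half_plane_powr[OF assms(3)]
  have c: "cos (Arg w) > 0" using W(4) by (intro cos_gt_zero_pi) auto
  have "Re w powr q = norm w powr q * cos (Arg w) powr q"
    by (subst W(3)) (use c in \<open>simp add: powr_mult\<close>)
  also have "\<dots> \<le> norm w powr q * (cos (pi / (2 * q)) powr q + tangent_slope q * cos (q * Arg w))"
    using cos_powr_le[OF assms(1,2) W(4)] by (intro mult_left_mono) auto
  finally show ?thesis by (simp add: W(2) algebra_simps)
qed

section \<open>Area integrals over the disk\<close>

lemma lborel_complex_eq: "(lborel :: complex measure) = distr (lborel \<Otimes>\<^sub>M lborel) borel (\<lambda>(x, y). Complex x y)"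
proof (rule lborel_eqI)
  have m: "(\<lambda>(x, y). Complex x y) \<in> lborel \<Otimes>\<^sub>M lborel \<rightarrow>\<^sub>M (borel :: complex measure)"
    unfolding Complex_eq by simp
  fix l u :: complex assume lu: "\<And>b. b \<in> Basis \<Longrightarrow> l \<bullet> b \<le> u \<bullet> b"
  have "(\<lambda>(x, y). Complex x y) -` box l u = {Re l<..<Re u} \<times> {Im l<..<Im u}"
    by (auto simp: box_def Basis_complex_def inner_complex_def)
  then show "emeasure (distr (lborel \<Otimes>\<^sub>M lborel) borel (\<lambda>(x, y). Complex x y)) (box l u)
     = (\<Prod>b\<in>Basis. (u - l) \<bullet> b)"
    using lu[of 1] lu[of \<i>] m
    by (subst emeasure_distr)
       (auto simp: space_pair_measure lborel.emeasure_pair_measure_Times Basis_complex_def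
          inner_complex_def ennreal_mult)
qed simp

lemma nn_integral_lborel_complex:
  assumes [measurable]: "\<phi> \<in> borel_measurable borel"
  shows "(\<integral>\<^sup>+z. \<phi> z \<partial>lborel) = (\<integral>\<^sup>+x. \<integral>\<^sup>+y. \<phi> (Complex x y) \<partial>lborel \<partial>lborel)"
    and "(\<integral>\<^sup>+z. \<phi> z \<partial>lborel) = (\<integral>\<^sup>+y. \<integral>\<^sup>+x. \<phi> (Complex x y) \<partial>lborel \<partial>lborel)"
proof -
  have m [measurable]: "(\<lambda>(x, y). Complex x y) \<in> borel \<Otimes>\<^sub>M borel \<rightarrow>\<^sub>M (borel :: complex measure)"
    unfolding Complex_eq by simp
  show 1: "(\<integral>\<^sup>+z. \<phi> z \<partial>lborel) = (\<integral>\<^sup>+x. \<integral>\<^sup>+y. \<phi> (Complex x y) \<partial>lborel \<partial>lborel)"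
    by (simp add: lborel_complex_eq nn_integral_distr lborel.nn_integral_fst[symmetric])
  show "(\<integral>\<^sup>+z. \<phi> z \<partial>lborel) = (\<integral>\<^sup>+y. \<integral>\<^sup>+x. \<phi> (Complex x y) \<partial>lborel \<partial>lborel)"
    unfolding 1 by (rule lborel_pair.Fubini'[symmetric]) simp
qed

lemma nn_integral_lborel_translate:
  assumes [measurable]: "\<phi> \<in> borel_measurable borel"
  shows "(\<integral>\<^sup>+x. \<phi> (x + a :: real) \<partial>lborel) = (\<integral>\<^sup>+x. \<phi> x \<partial>lborel)"
  by (subst (2) lborel_distr_plus[of a, symmetric])
     (simp add: nn_integral_distr add.commute)

text \<open>
After Fubini, a shear is a translation in one variable by an amount that depends only on the other.
\<close>

lemma nn_integral_shear:
  assumes [measurable]: "\<phi> \<in> borel_measurable borel"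
  shows "(\<integral>\<^sup>+z. \<phi> (z + of_real (t * Im z)) \<partial>lborel) = (\<integral>\<^sup>+z. \<phi> z \<partial>lborel)"
    and "(\<integral>\<^sup>+z. \<phi> (z + \<i> * of_real (t * Re z)) \<partial>lborel) = (\<integral>\<^sup>+z. \<phi> z \<partial>lborel)"
proof -
  have [measurable]: "(\<lambda>x. \<phi> (Complex x y)) \<in> borel_measurable borel" 
     "(\<lambda>x. \<phi> (Complex y x)) \<in> borel_measurable borel" for y
    unfolding Complex_eq by measurable
  have "(\<lambda>z. z + complex_of_real (t * Im z)) \<in> borel_measurable borel"
    "(\<lambda>z. z + \<i> * complex_of_real (t * Re z)) \<in> borel_measurable borel"
    by (auto intro!: borel_measurable_continuous_onI continuous_intros)
  note [measurable] = this
  have e: "Complex x y + of_real (t * y) = Complex (x + t * y) y"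
     "Complex x y + \<i> * of_real (t * x) = Complex x (y + t * x)" for x y
    by (auto simp: complex_eq_iff)
  show "(\<integral>\<^sup>+z. \<phi> (z + of_real (t * Im z)) \<partial>lborel) = (\<integral>\<^sup>+z. \<phi> z \<partial>lborel)"
    by (subst (1 2) nn_integral_lborel_complex(2))
       (auto simp del: of_real_mult simp: e nn_integral_lborel_translate[of "\<lambda>x. \<phi> (Complex x _)"])
  show "(\<integral>\<^sup>+z. \<phi> (z + \<i> * of_real (t * Re z)) \<partial>lborel) = (\<integral>\<^sup>+z. \<phi> z \<partial>lborel)"
    by (subst (1 2) nn_integral_lborel_complex(1))
       (auto simp del: of_real_mult simp: e nn_integral_lborel_translate[of "\<lambda>y. \<phi> (Complex _ y)"])
qed

text \<open>
A rotation by \<open>2 * t\<close> is a product of three shears, with parameters \<open>- tan t\<close>, \<open>sin (2 * t)\<close> and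
\<open>- tan t\<close>.  This fails only for \<open>cos t = 0\<close>, that is for half turns, which are squares of quarter
turns.
\<close>

lemma nn_integral_rotate:
  assumes [measurable]: "\<phi> \<in> borel_measurable borel"
  shows "(\<integral>\<^sup>+z. \<phi> (cis \<theta> * z) \<partial>lborel) = (\<integral>\<^sup>+z. \<phi> z \<partial>lborel)"
proof -
  have main: "(\<integral>\<^sup>+z. \<psi> (cis (2 * t) * z) \<partial>lborel) = (\<integral>\<^sup>+z. \<psi> z \<partial>lborel)"
    if [measurable]: "\<psi> \<in> borel_measurable borel" and c: "cos t \<noteq> 0" for \<psi> :: "complex \<Rightarrow> ennreal" and t
  proof -
    define A where "A = (\<lambda>z. z + complex_of_real (- tan t * Im z))"
    define B where "B = (\<lambda>z. z + \<i> * complex_of_real (sin (2 * t) * Re z))"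
    have [measurable]: "A \<in> borel_measurable borel" "B \<in> borel_measurable borel"
      unfolding A_def B_def by (auto intro!: borel_measurable_continuous_onI continuous_intros)
    have "A (B (A z)) = cis (2 * t) * z" for z
    proof -
      have t1: "tan t * sin (2 * t) = 1 - cos (2 * t)"
        using c by (simp add: sin_double cos_double_sin tan_def power2_eq_square)
      have t2: "tan t * (1 + cos (2 * t)) = sin (2 * t)"
        using c by (simp add: sin_double cos_double_cos tan_def power2_eq_square)
      have t3: "1 - tan t * sin (2 * t) = cos (2 * t)" using t1 by simp
      have "Re (A (B (A z))) = Re z * (1 - tan t * sin (2*t)) - Im z * (tan t * (2 - tan t * sin (2 * t)))"
        by (simp add: A_def B_def algebra_simps)
      moreover have "Im (A (B (A z))) = Im z * (1 - tan t * sin (2 * t)) + Re z * sin (2 * t)"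
        by (simp add: A_def B_def algebra_simps)
      moreover have "tan t * (2 - tan t * sin (2 * t)) = sin (2 * t)" using t1 t2 by simp
      ultimately show ?thesis
        unfolding t3 by (simp add: complex_eq_iff)
    qed
    then have "(\<integral>\<^sup>+z. \<psi> (cis (2 * t) * z) \<partial>lborel) = (\<integral>\<^sup>+z. \<psi> (A (B (A z))) \<partial>lborel)" by simp
    also have "\<dots> = (\<integral>\<^sup>+z. \<psi> (A (B z)) \<partial>lborel)"
      unfolding A_def by (rule nn_integral_shear) (auto simp flip: A_def)
    also have "\<dots> = (\<integral>\<^sup>+z. \<psi> (A z) \<partial>lborel)"
      unfolding B_def by (rule nn_integral_shear) (auto simp flip: A_def)
    also have "\<dots> = (\<integral>\<^sup>+z. \<psi> z \<partial>lborel)"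
      unfolding A_def by (rule nn_integral_shear) auto
    finally show ?thesis .
  qed
  show ?thesis
  proof (cases "cos (\<theta> / 2) = 0")
    case False
    then show ?thesis using main[of \<phi> "\<theta> / 2"] by simp
  next
    case True
    have c: "cos (\<theta> / 4) \<noteq> 0"
      using True cos_double_cos[of "\<theta> / 4"] by auto
    have "(\<integral>\<^sup>+z. \<phi> (cis \<theta> * z) \<partial>lborel) = (\<integral>\<^sup>+z. \<phi> (cis (2 * (\<theta> / 4)) * (cis (2 * (\<theta> / 4)) * z)) \<partial>lborel)"
      by (simp add: mult.assoc[symmetric] cis_mult)
    also have "\<dots> = (\<integral>\<^sup>+z. \<phi> z \<partial>lborel)"
      using main[of \<phi>, OF _ c] main[of "\<lambda>z. \<phi> (cis (2 * (\<theta> / 4)) * z)", OF _ c] by simp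
    finally show ?thesis .
  qed
qed

text \<open>
The layer cake formula: \<open>norm z ^ N\<close> is the integral of \<open>N * t ^ (N - 1)\<close> over \<open>0 \<le> t \<le> norm z\<close>,
and for fixed \<open>t\<close> the annulus \<open>t \<le> norm z < 1\<close> has area \<open>pi * (1 - t\<^sup>2)\<close>.
\<close>

lemma nn_integral_norm_power_disk:
  "(\<integral>\<^sup>+z\<in>ball (0::complex) 1. ennreal (norm z ^ (2 * n)) \<partial>lborel) = ennreal (pi / (n + 1))"
proof -
  have area: "emeasure lborel (ball (0::complex) r) = ennreal (pi * r\<^sup>2)" if "r \<ge> 0" for r
    using that by (simp add: emeasure_ball unit_ball_vol_2 ennreal_mult)
  show ?thesis
  proof (cases "n = 0")
    case True
    then show ?thesis using area[of 1] by (simp add: nn_integral_indicator)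
  next
    case False
    define N where "N = 2 * n"
    have N: "N \<ge> 2" using False by (simp add: N_def)
    define K where "K = (\<lambda>(t::real) (z::complex). ennreal (N * t ^ (N - 1)) * indicator {0..1} t
         * indicator (ball 0 1 - ball 0 t) z)"
    have [measurable]: "(\<lambda>(t, z). K t z) \<in> borel_measurable (borel \<Otimes>\<^sub>M borel)"
      "(\<lambda>(z, t). K t z) \<in> borel_measurable (borel \<Otimes>\<^sub>M borel)"
    proof -
      have eq: "indicator (ball 0 1 - ball (0::complex) t) z
         = (if norm z < 1 \<and> t \<le> norm z then 1 else 0 :: ennreal)" for t z
        by (auto simp: indicator_def)
      show "(\<lambda>(t, z). K t z) \<in> borel_measurable (borel \<Otimes>\<^sub>M borel)"
        "(\<lambda>(z, t). K t z) \<in> borel_measurable (borel \<Otimes>\<^sub>M borel)"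
        unfolding K_def eq by measurable
    qed
    have inner: "(\<integral>\<^sup>+t. K t z \<partial>lborel) = ennreal (norm z ^ N) * indicator (ball 0 1) z" for z
    proof (cases "norm z < 1")
      case True
      have "(\<integral>\<^sup>+t. K t z \<partial>lborel) = (\<integral>\<^sup>+t. ennreal (N * t ^ (N - 1)) * indicator {0..norm z} t \<partial>lborel)"
        using True by (intro nn_integral_cong) (auto simp: K_def indicator_def)
      also have "\<dots> = ennreal (norm z ^ N - 0 ^ N)"
        by (rule nn_integral_FTC_Icc) (auto intro!: derivative_eq_intros)
      finally show ?thesis using True N by simp
    qed (simp add: K_def)
    have outer: "(\<integral>\<^sup>+z. K t z \<partial>lborel) = ennreal (N * t ^ (N - 1) * (pi * (1 - t\<^sup>2))) * indicator {0..1} t" for t :: real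
    proof (cases "t \<in> {0..1}")
      case True
      have "(\<integral>\<^sup>+z. K t z \<partial>lborel)
         = ennreal (N * t ^ (N - 1)) * (emeasure lborel (ball (0::complex) 1 - ball 0 t))"
        using True unfolding K_def by (subst nn_integral_cmult_indicator) auto
      also have "emeasure lborel (ball (0::complex) 1 - ball 0 t) = ennreal (pi * (1 - t\<^sup>2))"
        using True
        by (subst emeasure_Diff) (auto simp: area ennreal_minus algebra_simps)
      finally show ?thesis using True by (simp add: ennreal_mult power_le_one)
    qed (simp add: K_def)
    have "(\<integral>\<^sup>+z\<in>ball (0::complex) 1. ennreal (norm z ^ N) \<partial>lborel) = (\<integral>\<^sup>+z. \<integral>\<^sup>+t. K t z \<partial>lborel \<partial>lborel)"
      by (simp add: inner)
    also have "\<dots> = (\<integral>\<^sup>+t. \<integral>\<^sup>+z. K t z \<partial>lborel \<partial>lborel)"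
      by (rule lborel_pair.Fubini') simp
    also have "\<dots> = (\<integral>\<^sup>+t. ennreal (N * t ^ (N - 1) * (pi * (1 - t\<^sup>2))) * indicator {0..1} t \<partial>lborel)"
      by (simp add: outer)
    also have "\<dots> = ennreal (pi * (1 ^ N - real N * 1 ^ (N + 2) / real (N + 2))
          - pi * (0 ^ N - real N * 0 ^ (N + 2) / real (N + 2)))"
    proof (rule nn_integral_FTC_Icc)
      fix t :: real assume "t \<in> {0..1}"
      have "t ^ (N + 1) = t ^ (N - 1) * t\<^sup>2"
        using N by (simp flip: power_add)
      then have e: "pi * (real N * t ^ (N - 1) - real N * (real (N + 2) * t ^ (N + 1)) / real (N + 2))
          = real N * t ^ (N - 1) * (pi * (1 - t\<^sup>2))"
        by (simp add: right_diff_distrib del: of_nat_add)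
      have "((\<lambda>t. pi * (t ^ N - real N * t ^ (N + 2) / real (N + 2))) has_real_derivative
          pi * (real N * t ^ (N - 1) - real N * (real (N + 2) * t ^ (N + 1)) / real (N + 2))) (at t)"
        by (rule derivative_eq_intros refl | simp)+
      then show "((\<lambda>t. pi * (t ^ N - real N * t ^ (N + 2) / real (N + 2))) has_real_derivative
             real N * t ^ (N - 1) * (pi * (1 - t\<^sup>2))) (at t)"
        by (simp only: e)
    qed (auto simp: power_le_one)
    also have "\<dots> = ennreal (pi / (n + 1))"
    proof -
      have "(0::real) ^ N = 0" "(0::real) ^ (N + 2) = 0" "real N = 2 * n" "real (N + 2) = 2 * (n + 1)"
        using N by (auto simp: N_def)
      then show ?thesis by (simp only:) (simp add: field_simps)
    qed
    finally show ?thesis by (simp add: N_def)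
  qed
qed

text \<open>
A substitute for polar coordinates: by rotation invariance an integral over the disk does not change
when the integrand is rotated by \<open>\<theta>\<close>, so it may be averaged over all \<open>\<theta>\<close>.
\<close>

lemma nn_integral_disk_circle_average:
  assumes [measurable]: "\<phi> \<in> borel_measurable borel"
  shows "ennreal (2 * pi) * (\<integral>\<^sup>+z\<in>ball 0 1. \<phi> z \<partial>lborel)
    = (\<integral>\<^sup>+z\<in>ball 0 1. (\<integral>\<^sup>+\<theta>\<in>{0..2*pi}. \<phi> (cis \<theta> * z) \<partial>lborel) \<partial>lborel)"
proof -
  define K where "K = (\<lambda>\<theta> z. \<phi> (cis \<theta> * z) * indicator {0..2*pi} \<theta> * indicator (ball 0 1) z)"
  have [measurable]: "ball (0::complex) 1 \<in> sets borel" by simp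
  have [measurable]: "cis \<in> borel_measurable borel"
    by (auto intro!: borel_measurable_continuous_onI continuous_intros)
  have ind: "indicator (ball 0 1) z = (if norm z < 1 then 1 else 0 :: ennreal)" for z :: complex
    by (auto simp: indicator_def)
  have [measurable]: "(\<lambda>(\<theta>, z). K \<theta> z) \<in> borel_measurable (borel \<Otimes>\<^sub>M borel)"
    unfolding K_def case_prod_beta ind by measurable
  have [measurable]: "(\<lambda>(z, \<theta>). K \<theta> z) \<in> borel_measurable (borel \<Otimes>\<^sub>M borel)"
    unfolding K_def case_prod_beta ind by measurable
  have [measurable]: "(\<lambda>\<theta>. \<phi> (cis \<theta> * z)) \<in> borel_measurable borel" for z
  proof -
    have "(\<lambda>\<theta>. cis \<theta> * z) \<in> borel_measurable borel"
      by (auto intro!: borel_measurable_continuous_onI continuous_intros)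
    then show ?thesis by measurable
  qed
  have "(\<integral>\<^sup>+z\<in>ball 0 1. (\<integral>\<^sup>+\<theta>\<in>{0..2*pi}. \<phi> (cis \<theta> * z) \<partial>lborel) \<partial>lborel)
     = (\<integral>\<^sup>+z. \<integral>\<^sup>+\<theta>. K \<theta> z \<partial>lborel \<partial>lborel)"
    unfolding K_def by (subst nn_integral_multc) auto
  also have "\<dots> = (\<integral>\<^sup>+\<theta>. \<integral>\<^sup>+z. K \<theta> z \<partial>lborel \<partial>lborel)"
    by (rule lborel_pair.Fubini') simp
  also have "\<dots> = (\<integral>\<^sup>+\<theta>. (\<integral>\<^sup>+z\<in>ball 0 1. \<phi> z \<partial>lborel) * indicator {0..2*pi} \<theta> \<partial>lborel)"
  proof (rule nn_integral_cong)
    fix \<theta>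
    have "(\<integral>\<^sup>+z. K \<theta> z \<partial>lborel) = (\<integral>\<^sup>+z. (\<lambda>w. \<phi> w * indicator (ball 0 1) w * indicator {0..2*pi} \<theta>) (cis \<theta> * z) \<partial>lborel)"
      by (intro nn_integral_cong) (auto simp: K_def indicator_def norm_mult)
    also have "\<dots> = (\<integral>\<^sup>+z. \<phi> z * indicator (ball 0 1) z * indicator {0..2*pi} \<theta> \<partial>lborel)"
      by (rule nn_integral_rotate) auto
    also have "\<dots> = (\<integral>\<^sup>+z\<in>ball 0 1. \<phi> z \<partial>lborel) * indicator {0..2*pi} \<theta>"
      by (rule nn_integral_multc) auto
    finally show "(\<integral>\<^sup>+z. K \<theta> z \<partial>lborel) = (\<integral>\<^sup>+z\<in>ball 0 1. \<phi> z \<partial>lborel) * indicator {0..2*pi} \<theta>" .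
  qed
  also have "\<dots> = (\<integral>\<^sup>+z\<in>ball 0 1. \<phi> z \<partial>lborel) * ennreal (2 * pi)"
    by (subst nn_integral_cmult_indicator) auto
  finally show ?thesis by (simp add: mult.commute)
qed

section \<open>Harmonic functions as sums of holomorphic and antiholomorphic functions\<close>

lemma directional_derivative:
  assumes "(\<lambda>t::real. f (z + t *\<^sub>R b)) differentiable (at 0)" and "z = w + s *\<^sub>R b"
  shows "((\<lambda>t. f (w + t *\<^sub>R b)) has_vector_derivative partial_deriv b f z) (at s within X)"
proof -
  have "((\<lambda>t::real. f (z + t *\<^sub>R b)) has_vector_derivative partial_deriv b f z) (at 0)"
    using assms(1) unfolding partial_deriv_def by (simp add: vector_derivative_works)
  moreover have "((\<lambda>t::real. t - s) has_vector_derivative 1) (at s)"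
    by (auto intro!: derivative_eq_intros simp: has_vector_derivative_def)
  ultimately have "(((\<lambda>t. f (z + t *\<^sub>R b)) \<circ> (\<lambda>t. t - s)) has_vector_derivative 1 *\<^sub>R partial_deriv b f z) (at s)"
    by (intro vector_diff_chain_at) auto
  moreover have "(\<lambda>t. f (z + t *\<^sub>R b)) \<circ> (\<lambda>t. t - s) = (\<lambda>t. f (w + t *\<^sub>R b))"
    unfolding assms(2) by (auto simp: fun_eq_iff algebra_simps)
  ultimately show ?thesis by (simp add: has_vector_derivative_at_within)
qed

text \<open>
The mean value inequality along one coordinate direction.  Being valid for any normed target space,
it avoids splitting complex-valued functions into components.
\<close>

lemma partial_increment_bound:
  fixes f :: "'a::euclidean_space \<Rightarrow> 'b::real_normed_vector"
  assumes diff: "\<And>s. s \<in> closed_segment 0 t \<Longrightarrow> (\<lambda>u::real. f ((w + s *\<^sub>R b) + u *\<^sub>R b)) differentiable (at 0)"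
    and bd: "\<And>s. s \<in> closed_segment 0 t \<Longrightarrow> norm (partial_deriv b f (w + s *\<^sub>R b) - A) \<le> e"
  shows "norm (f (w + t *\<^sub>R b) - f w - t *\<^sub>R A) \<le> e * \<bar>t\<bar>"
proof -
  have "norm ((f (w + t *\<^sub>R b) - t *\<^sub>R A) - (f (w + 0 *\<^sub>R b) - 0 *\<^sub>R A)) \<le> e * norm (t - 0)"
  proof (rule differentiable_bound[where S = "closed_segment 0 t"
        and f' = "\<lambda>s h. h *\<^sub>R (partial_deriv b f (w + s *\<^sub>R b) - A)"])
    fix s assume s: "s \<in> closed_segment 0 t"
    show "((\<lambda>t. f (w + t *\<^sub>R b) - t *\<^sub>R A) has_derivative
        (\<lambda>h. h *\<^sub>R (partial_deriv b f (w + s *\<^sub>R b) - A))) (at s within closed_segment 0 t)"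
      using directional_derivative[OF diff[OF s] refl, of "closed_segment 0 t"]
      unfolding has_vector_derivative_def
      by (auto intro!: derivative_eq_intros simp: algebra_simps)
    show "onorm (\<lambda>h. h *\<^sub>R (partial_deriv b f (w + s *\<^sub>R b) - A)) \<le> e"
      using mult_left_mono[OF bd[OF s] abs_ge_zero] by (intro onorm_le) (simp add: mult.commute)
  qed auto
  then show ?thesis by (simp add: algebra_simps)
qed

lemma partial_deriv_near:
  fixes f :: "'a::euclidean_space \<Rightarrow> 'b::real_normed_vector"
  assumes "C1_on S f" "open S" "z \<in> S" "b \<in> Basis" "0 < e"
  shows "\<exists>d>0. ball z d \<subseteq> S \<and> (\<forall>w\<in>ball z d. norm (partial_deriv b f w - partial_deriv b f z) \<le> e)"
proof -
  have "continuous_on S (partial_deriv b f)" using assms by (auto simp: C1_on_def)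
  then have "continuous (at z) (partial_deriv b f)"
    using assms by (simp add: continuous_on_eq_continuous_at)
  then obtain d1 where d1: "d1 > 0"
    "\<And>w. dist w z < d1 \<Longrightarrow> dist (partial_deriv b f w) (partial_deriv b f z) < e"
    using \<open>0 < e\<close> unfolding continuous_at_eps_delta by blast
  obtain d2 where d2: "d2 > 0" "ball z d2 \<subseteq> S" using assms openE by blast
  show ?thesis
  proof (intro exI[of _ "min d1 d2"] conjI ballI)
    show "norm (partial_deriv b f w - partial_deriv b f z) \<le> e" if "w \<in> ball z (min d1 d2)" for w
      using d1(2)[of w] that by (simp add: dist_norm norm_minus_commute)
  qed (use d1 d2 in auto)
qed

text \<open>
Two mean value inequalities, one in each direction, show that \<open>h * h\<close> times the mixed derivative
approximates the second difference of \<open>f\<close>.  Since the second difference is symmetric in \<open>b\<close> and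
\<open>c\<close>, the mixed derivatives have to agree.
\<close>

lemma second_difference_estimate:
  fixes f :: "'a::euclidean_space \<Rightarrow> 'b::real_normed_vector"
  assumes S: "open S" "z \<in> S" and f: "C1_on S f" "C1_on S (partial_deriv b f)"
    and bc: "b \<in> Basis" "c \<in> Basis" and e: "0 < e"
  shows "\<exists>d>0. \<forall>h. 0 < h \<and> h < d \<longrightarrow>
    norm (f (z + h *\<^sub>R b + h *\<^sub>R c) - f (z + h *\<^sub>R b) - f (z + h *\<^sub>R c) + f z
       - (h * h) *\<^sub>R partial_deriv c (partial_deriv b f) z) \<le> e * (h * h)"
proof -
  let ?g = "partial_deriv b f" and ?A = "partial_deriv c (partial_deriv b f) z"
  obtain r where r: "r > 0" "ball z r \<subseteq> S" "\<And>w. w \<in> ball z r \<Longrightarrow> norm (partial_deriv c ?g w - ?A) \<le> e"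
    using partial_deriv_near[OF f(2) S bc(2) e] by blast
  show ?thesis
  proof (intro exI[of _ "r / 2"] conjI allI impI)
    fix h assume h: "0 < h \<and> h < r / 2"
    have mem: "z + s *\<^sub>R b + t *\<^sub>R c \<in> ball z r" if "0 \<le> s" "s \<le> h" "0 \<le> t" "t \<le> h" for s t
    proof -
      have "norm (s *\<^sub>R b + t *\<^sub>R c) \<le> s + t"
        using norm_triangle_ineq[of "s *\<^sub>R b" "t *\<^sub>R c"] that bc by simp
      moreover have "dist z (z + s *\<^sub>R b + t *\<^sub>R c) = norm (s *\<^sub>R b + t *\<^sub>R c)"
        by (metis add.assoc add_diff_cancel_left' dist_commute dist_norm)
      ultimately show ?thesis using that h by simp
    qed
    have seg: "closed_segment 0 h = {0..h}" using h by (simp add: closed_segment_eq_real_ivl)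
    define F where "F = (\<lambda>w. f (w + h *\<^sub>R c) - f w)"
    have F: "((\<lambda>t. F (w + t *\<^sub>R b)) has_vector_derivative ?g (w + h *\<^sub>R c) - ?g w) (at 0)"
      if "w + h *\<^sub>R c \<in> S" "w \<in> S" for w
    proof -
      have "((\<lambda>t. f (w + h *\<^sub>R c + t *\<^sub>R b)) has_vector_derivative ?g (w + h *\<^sub>R c)) (at 0)"
        "((\<lambda>t. f (w + t *\<^sub>R b)) has_vector_derivative ?g w) (at 0)"
        using f(1) bc that by (auto intro!: directional_derivative simp: C1_on_def)
      then have "((\<lambda>t. f (w + h *\<^sub>R c + t *\<^sub>R b) - f (w + t *\<^sub>R b)) has_vector_derivative
          ?g (w + h *\<^sub>R c) - ?g w) (at 0)"
        by (rule has_vector_derivative_diff)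
      then show ?thesis by (simp add: F_def add_ac)
    qed
    have "norm (F (z + h *\<^sub>R b) - F z - h *\<^sub>R (h *\<^sub>R ?A)) \<le> (e * h) * \<bar>h\<bar>"
    proof (rule partial_increment_bound)
      fix s assume s: "s \<in> closed_segment 0 h"
      have in_S: "z + s *\<^sub>R b + h *\<^sub>R c \<in> S" "z + s *\<^sub>R b \<in> S"
        using mem[of s h] mem[of s 0] s seg r h by auto
      note Fs = F[OF in_S]
      show "(\<lambda>u. F (z + s *\<^sub>R b + u *\<^sub>R b)) differentiable at 0"
        using Fs by (rule differentiableI_vector)
      have "partial_deriv b F (z + s *\<^sub>R b) = ?g (z + s *\<^sub>R b + h *\<^sub>R c) - ?g (z + s *\<^sub>R b)"
        unfolding partial_deriv_def[of b F] by (rule vector_derivative_at[OF Fs])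
      moreover have "norm (?g ((z + s *\<^sub>R b) + h *\<^sub>R c) - ?g (z + s *\<^sub>R b) - h *\<^sub>R ?A) \<le> e * \<bar>h\<bar>"
      proof (rule partial_increment_bound)
        fix t assume t: "t \<in> closed_segment 0 h"
        have m: "z + s *\<^sub>R b + t *\<^sub>R c \<in> ball z r" using mem[of s t] s t seg by auto
        then show "(\<lambda>u. ?g (z + s *\<^sub>R b + t *\<^sub>R c + u *\<^sub>R c)) differentiable at 0"
          using f(2) bc r by (auto simp: C1_on_def)
        show "norm (partial_deriv c ?g (z + s *\<^sub>R b + t *\<^sub>R c) - ?A) \<le> e" using r(3)[OF m] .
      qed
      ultimately show "norm (partial_deriv b F (z + s *\<^sub>R b) - h *\<^sub>R ?A) \<le> e * h" using h by simp
    qed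
    then show "norm (f (z + h *\<^sub>R b + h *\<^sub>R c) - f (z + h *\<^sub>R b) - f (z + h *\<^sub>R c) + f z
       - (h * h) *\<^sub>R ?A) \<le> e * (h * h)"
      using h by (simp add: F_def algebra_simps)
  qed (use r in simp)
qed

lemma mixed_partial_derivs_commute:
  fixes f :: "'a::euclidean_space \<Rightarrow> 'b::real_normed_vector"
  assumes "open S" "z \<in> S" "C2_on S f" "b \<in> Basis" "c \<in> Basis"
  shows "partial_deriv c (partial_deriv b f) z = partial_deriv b (partial_deriv c f) z"
proof -
  let ?A = "partial_deriv c (partial_deriv b f) z" and ?B = "partial_deriv b (partial_deriv c f) z"
  have "norm (?A - ?B) \<le> 0 + e" if "e > 0" for e
  proof -
    define D where "D = (\<lambda>h. f (z + h *\<^sub>R b + h *\<^sub>R c) - f (z + h *\<^sub>R b) - f (z + h *\<^sub>R c) + f z)"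
    have C: "C1_on S f" "C1_on S (partial_deriv b f)" "C1_on S (partial_deriv c f)"
      using assms by (auto simp: C2_on_def)
    obtain d1 where d1: "d1 > 0" "\<And>h. 0 < h \<Longrightarrow> h < d1 \<Longrightarrow> norm (D h - (h * h) *\<^sub>R ?A) \<le> e / 2 * (h * h)"
      using second_difference_estimate[OF assms(1,2) C(1,2) assms(4,5), of "e/2"] \<open>e > 0\<close>
      unfolding D_def by auto
    obtain d2 where d2: "d2 > 0" "\<And>h. 0 < h \<Longrightarrow> h < d2 \<Longrightarrow> norm (D h - (h * h) *\<^sub>R ?B) \<le> e / 2 * (h * h)"
      using second_difference_estimate[OF assms(1,2) C(1,3) assms(5,4), of "e/2"] \<open>e > 0\<close>
      unfolding D_def by (auto simp: algebra_simps)
    define h where "h = min d1 d2 / 2"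
    have h: "0 < h" "h < d1" "h < d2" using d1(1) d2(1) by (auto simp: h_def)
    have "(h * h) * norm (?A - ?B) = norm ((D h - (h * h) *\<^sub>R ?B) - (D h - (h * h) *\<^sub>R ?A))"
      by (simp add: scaleR_diff_right[symmetric])
    also have "\<dots> \<le> e / 2 * (h * h) + e / 2 * (h * h)"
      by (intro order_trans[OF norm_triangle_ineq4] add_mono d1 d2 h)
    finally have "(h * h) * norm (?A - ?B) \<le> (h * h) * e" by (simp add: algebra_simps)
    then show ?thesis using h by (simp add: mult_le_cancel_left)
  qed
  then have "norm (?A - ?B) \<le> 0" by (rule field_le_epsilon)
  then show ?thesis by simp
qed

text \<open>
The increment of \<open>f\<close> is followed first along the real and then along the imaginary direction; continuity
of the partial derivatives makes the two mean value estimates uniform near \<open>z\<close>.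
\<close>

lemma C1_on_complex_has_derivative:
  fixes f :: "complex \<Rightarrow> 'b::real_normed_vector"
  assumes "open S" "z \<in> S" "C1_on S f"
  shows "(f has_derivative (\<lambda>h. Re h *\<^sub>R partial_deriv 1 f z + Im h *\<^sub>R partial_deriv \<i> f z)) (at z)"
  unfolding has_derivative_within_alt
proof (intro conjI allI impI)
  show "bounded_linear (\<lambda>h. Re h *\<^sub>R partial_deriv 1 f z + Im h *\<^sub>R partial_deriv \<i> f z)"
    by (intro bounded_linear_add bounded_linear_scaleR_const bounded_linear_Re bounded_linear_Im)
  fix e :: real assume e: "0 < e"
  have B: "(1::complex) \<in> Basis" "\<i> \<in> Basis" by (auto simp: Basis_complex_def)
  obtain d1 where d1: "d1 > 0" "ball z d1 \<subseteq> S"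
    "\<And>w. w \<in> ball z d1 \<Longrightarrow> norm (partial_deriv 1 f w - partial_deriv 1 f z) \<le> e / 2"
    using partial_deriv_near[OF assms(3,1,2) B(1), of "e/2"] e by auto
  obtain d2 where d2: "d2 > 0" "ball z d2 \<subseteq> S"
    "\<And>w. w \<in> ball z d2 \<Longrightarrow> norm (partial_deriv \<i> f w - partial_deriv \<i> f z) \<le> e / 2"
    using partial_deriv_near[OF assms(3,1,2) B(2), of "e/2"] e by auto
  show "\<exists>d>0. \<forall>y\<in>UNIV. norm (y - z) < d \<longrightarrow>
     norm (f y - f z - (Re (y - z) *\<^sub>R partial_deriv 1 f z + Im (y - z) *\<^sub>R partial_deriv \<i> f z))
      \<le> e * norm (y - z)"
  proof (intro exI[of _ "min d1 d2"] conjI ballI impI)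
    fix y assume y: "norm (y - z) < min d1 d2"
    define u v where "u = Re (y - z)" and "v = Im (y - z)"
    have yz: "y = z + u *\<^sub>R 1 + v *\<^sub>R \<i>" by (auto simp: u_def v_def complex_eq_iff)
    have uv: "\<bar>u\<bar> \<le> norm (y - z)" "\<bar>v\<bar> \<le> norm (y - z)"
      using abs_Re_le_cmod[of "y - z"] abs_Im_le_cmod[of "y - z"] by (auto simp: u_def v_def)
    have seg: "\<bar>s\<bar> \<le> \<bar>t\<bar>" if "s \<in> closed_segment 0 t" for s t :: real
      using that by (auto simp: closed_segment_eq_real_ivl split: if_splits)
    have 1: "norm (f (z + u *\<^sub>R 1) - f z - u *\<^sub>R partial_deriv 1 f z) \<le> e / 2 * \<bar>u\<bar>"
    proof (rule partial_increment_bound)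
      fix s assume "s \<in> closed_segment 0 u"
      then have m: "z + s *\<^sub>R 1 \<in> ball z d1" using seg[of s u] uv y by (simp add: dist_norm)
      then show "(\<lambda>t. f (z + s *\<^sub>R 1 + t *\<^sub>R 1)) differentiable at 0"
        using assms(3) B d1 unfolding C1_on_def by blast
      show "norm (partial_deriv 1 f (z + s *\<^sub>R 1) - partial_deriv 1 f z) \<le> e / 2" by (rule d1(3)[OF m])
    qed
    have 2: "norm (f ((z + u *\<^sub>R 1) + v *\<^sub>R \<i>) - f (z + u *\<^sub>R 1) - v *\<^sub>R partial_deriv \<i> f z) \<le> e / 2 * \<bar>v\<bar>"
    proof (rule partial_increment_bound)
      fix s assume "s \<in> closed_segment 0 v"
      then have sv: "\<bar>s\<bar> \<le> \<bar>v\<bar>" by (rule seg)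
      have "norm (u *\<^sub>R 1 + s *\<^sub>R \<i>) \<le> norm (y - z)"
        unfolding cmod_def using sv by (auto simp: u_def v_def intro!: real_sqrt_le_mono add_mono abs_le_square_iff[THEN iffD1])
      then have m: "z + u *\<^sub>R 1 + s *\<^sub>R \<i> \<in> ball z d2"
      proof -
        have "dist z (z + u *\<^sub>R 1 + s *\<^sub>R \<i>) = norm (u *\<^sub>R 1 + s *\<^sub>R \<i>)"
          by (metis add.assoc add_diff_cancel_left' dist_commute dist_norm)
        then show ?thesis using y \<open>norm (u *\<^sub>R 1 + s *\<^sub>R \<i>) \<le> norm (y - z)\<close> by simp
      qed
      then show "(\<lambda>t. f (z + u *\<^sub>R 1 + s *\<^sub>R \<i> + t *\<^sub>R \<i>)) differentiable at 0"
        using assms(3) B d2 unfolding C1_on_def by blast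
      show "norm (partial_deriv \<i> f (z + u *\<^sub>R 1 + s *\<^sub>R \<i>) - partial_deriv \<i> f z) \<le> e / 2" by (rule d2(3)[OF m])
    qed
    have "norm (f y - f z - (u *\<^sub>R partial_deriv 1 f z + v *\<^sub>R partial_deriv \<i> f z))
       \<le> e / 2 * \<bar>u\<bar> + e / 2 * \<bar>v\<bar>"
      using norm_triangle_mono[OF 1 2] unfolding yz by (simp add: algebra_simps)
    also have "\<dots> \<le> e / 2 * norm (y - z) + e / 2 * norm (y - z)"
      using uv e by (intro add_mono mult_left_mono) auto
    finally show "norm (f y - f z - (Re (y - z) *\<^sub>R partial_deriv 1 f z + Im (y - z) *\<^sub>R partial_deriv \<i> f z))
      \<le> e * norm (y - z)" by (simp add: u_def v_def)
  qed (use d1 d2 in auto)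
qed

lemma Cauchy_Riemann_holomorphic:
  fixes f :: "complex \<Rightarrow> complex"
  assumes "open S"
    and "\<And>z. z \<in> S \<Longrightarrow> (f has_derivative (\<lambda>h. Re h *\<^sub>R a z + Im h *\<^sub>R b z)) (at z)"
    and "\<And>z. z \<in> S \<Longrightarrow> b z = \<i> * a z"
  shows "f holomorphic_on S"
  unfolding holomorphic_on_open[OF assms(1)]
proof (intro ballI exI)
  fix z assume z: "z \<in> S"
  have "Re h *\<^sub>R a z + Im h *\<^sub>R b z = a z * h" for h
  proof -
    have "a z * h = a z * (complex_of_real (Re h) + \<i> * complex_of_real (Im h))"
      by (simp only: complex_eq[symmetric])
    then show ?thesis by (simp add: assms(3)[OF z] scaleR_conv_of_real algebra_simps)
  qed
  then have "(\<lambda>h. Re h *\<^sub>R a z + Im h *\<^sub>R b z) = (*) (a z)" by (simp add: fun_eq_iff)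
  then show "(f has_field_derivative a z) (at z)"
    using assms(2)[OF z] by (simp add: has_field_derivative_def)
qed

text \<open>
The function \<open>k\<close> below is twice the Wirtinger derivative of \<open>f\<close> with respect to \<open>z\<close>.  The Laplace
equation and the symmetry of the second derivatives are precisely the Cauchy-Riemann equations for
\<open>k\<close>.  If \<open>g\<close> is a primitive of \<open>k / 2\<close>, then \<open>f - g\<close> has vanishing derivative with respect to \<open>z\<close>,
so its conjugate is holomorphic.
\<close>

theorem harmonic_decomposition:
  fixes f :: "complex \<Rightarrow> complex"
  assumes f: "harmonic_on f S" and S: "convex S"
  obtains g h where "g holomorphic_on S" "h holomorphic_on S" "\<And>z. z \<in> S \<Longrightarrow> f z = g z + cnj (h z)"
proof -
  have oS: "open S" and C2: "C2_on S f" and lap: "\<And>z. z \<in> S \<Longrightarrow> laplacian f z = 0"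
    using f by (auto simp: harmonic_on_def)
  have B: "(1::complex) \<in> Basis" "\<i> \<in> Basis" by (auto simp: Basis_complex_def)
  let ?x = "partial_deriv 1 f" and ?y = "partial_deriv \<i> f"
  have C1: "C1_on S f" "C1_on S ?x" "C1_on S ?y" using C2 B by (auto simp: C2_on_def)
  define k where "k = (\<lambda>z. ?x z - \<i> * ?y z)"
  have "k holomorphic_on S"
  proof (rule Cauchy_Riemann_holomorphic[OF oS])
    fix z assume z: "z \<in> S"
    have "(k has_derivative (\<lambda>h. (Re h *\<^sub>R partial_deriv 1 ?x z + Im h *\<^sub>R partial_deriv \<i> ?x z)
          - \<i> * (Re h *\<^sub>R partial_deriv 1 ?y z + Im h *\<^sub>R partial_deriv \<i> ?y z))) (at z)"
      unfolding k_def
      by (intro has_derivative_mult_right has_derivative_diff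
          C1_on_complex_has_derivative[OF oS z C1(2)] C1_on_complex_has_derivative[OF oS z C1(3)])
    then show "(k has_derivative (\<lambda>h. Re h *\<^sub>R (partial_deriv 1 ?x z - \<i> * partial_deriv 1 ?y z)
        + Im h *\<^sub>R (partial_deriv \<i> ?x z - \<i> * partial_deriv \<i> ?y z))) (at z)"
      by (rule has_derivative_eq_rhs) (simp add: fun_eq_iff scaleR_conv_of_real algebra_simps)
    have "partial_deriv \<i> ?x z = partial_deriv 1 ?y z"
      by (rule mixed_partial_derivs_commute[OF oS z C2 B])
    moreover have "partial_deriv \<i> ?y z = - partial_deriv 1 ?x z"
      using lap[OF z] by (simp add: laplacian_complex add_eq_0_iff)
    ultimately show "partial_deriv \<i> ?x z - \<i> * partial_deriv \<i> ?y z
        = \<i> * (partial_deriv 1 ?x z - \<i> * partial_deriv 1 ?y z)"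
      by (simp add: algebra_simps)
  qed
  then obtain G where G: "\<And>z. z \<in> S \<Longrightarrow> (G has_field_derivative k z) (at z within S)"
    using holomorphic_convex_primitive'[OF S oS] by blast
  define g where "g = (\<lambda>z. G z / 2)"
  have g: "(g has_field_derivative k z / 2) (at z within S)" if "z \<in> S" for z
    unfolding g_def by (intro DERIV_cdivide G that)
  have hol: "g holomorphic_on S" using g by (auto simp: holomorphic_on_def field_differentiable_def)
  have "(\<lambda>z. cnj (f z - g z)) holomorphic_on S"
  proof (rule Cauchy_Riemann_holomorphic[OF oS])
    fix z assume z: "z \<in> S"
    have gd: "(g has_derivative (\<lambda>h. k z / 2 * h)) (at z)"
      using g[OF z] unfolding at_within_open[OF z oS] has_field_derivative_def .
    have "((\<lambda>z. f z - g z) has_derivative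
       (\<lambda>h. (Re h *\<^sub>R ?x z + Im h *\<^sub>R ?y z) - k z / 2 * h)) (at z)"
      by (intro has_derivative_diff C1_on_complex_has_derivative[OF oS z C1(1)] gd)
    then have "((\<lambda>z. cnj (f z - g z)) has_derivative
       (\<lambda>h. cnj ((Re h *\<^sub>R ?x z + Im h *\<^sub>R ?y z) - k z / 2 * h))) (at z)"
      by (rule has_derivative_cnj)
    moreover have "(\<lambda>h. cnj ((Re h *\<^sub>R ?x z + Im h *\<^sub>R ?y z) - k z / 2 * h))
       = (\<lambda>h. Re h *\<^sub>R cnj (?x z - k z / 2) + Im h *\<^sub>R cnj (?y z - \<i> * (k z / 2)))"
    proof
      fix h
      have "k z / 2 * h = Re h *\<^sub>R (k z / 2) + Im h *\<^sub>R (\<i> * (k z / 2))"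
      proof -
        have "k z / 2 * h = k z / 2 * (complex_of_real (Re h) + \<i> * complex_of_real (Im h))"
          by (simp only: complex_eq[symmetric])
        also have "\<dots> = Re h *\<^sub>R (k z / 2) + Im h *\<^sub>R (\<i> * (k z / 2))"
          unfolding scaleR_conv_of_real distrib_left by (simp only: mult_ac)
        finally show ?thesis .
      qed
      then show "cnj ((Re h *\<^sub>R ?x z + Im h *\<^sub>R ?y z) - k z / 2 * h)
         = Re h *\<^sub>R cnj (?x z - k z / 2) + Im h *\<^sub>R cnj (?y z - \<i> * (k z / 2))"
        by (simp only: complex_cnj_diff complex_cnj_add complex_cnj_scaleR scaleR_diff_right add_diff_add)
    qed
    ultimately show "((\<lambda>z. cnj (f z - g z)) has_derivative
      (\<lambda>h. Re h *\<^sub>R cnj (?x z - k z / 2) + Im h *\<^sub>R cnj (?y z - \<i> * (k z / 2)))) (at z)" by simp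
    show "cnj (?y z - \<i> * (k z / 2)) = \<i> * cnj (?x z - k z / 2)"
      by (auto simp: k_def complex_eq_iff field_simps)
  qed
  then show thesis using that[OF hol, of "\<lambda>z. cnj (f z - g z)"] by simp
qed

section \<open>Circle averages and the Poisson formula\<close>

definition circle_avg :: "(real \<Rightarrow> 'a::euclidean_space) \<Rightarrow> 'a" where
  "circle_avg \<phi> = (1 / (2 * pi)) *\<^sub>R integral {0..2 * pi} \<phi>"

lemma circle_avg_cong: "(\<And>\<theta>. \<phi> \<theta> = \<psi> \<theta>) \<Longrightarrow> circle_avg \<phi> = circle_avg \<psi>"
  by presburger

lemma circle_avg_const [simp]: "circle_avg (\<lambda>\<theta>. c) = c"
  by (simp add: circle_avg_def)

lemma circle_avg_add:
  "continuous_on {0..2*pi} \<phi> \<Longrightarrow> continuous_on {0..2*pi} \<psi> \<Longrightarrow>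
    circle_avg (\<lambda>\<theta>. \<phi> \<theta> + \<psi> \<theta>) = circle_avg \<phi> + circle_avg \<psi>"
  by (simp add: circle_avg_def integral_add integrable_continuous_real scaleR_add_right)

lemma circle_avg_mult_left:
  fixes c :: "'a::{euclidean_space,real_normed_field}"
  assumes "continuous_on {0..2*pi} \<phi>"
  shows "circle_avg (\<lambda>\<theta>. c * \<phi> \<theta>) = c * circle_avg \<phi>"
proof -
  have "integral {0..2*pi} (\<lambda>\<theta>. c * \<phi> \<theta>) = c * integral {0..2*pi} \<phi>"
    by (intro integral_unique has_integral_mult_right integrable_integral
        integrable_continuous_real assms)
  then show ?thesis by (simp add: circle_avg_def)
qed

lemma circle_avg_linear:
  fixes L :: "'a::euclidean_space \<Rightarrow> 'b::euclidean_space"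
  assumes "continuous_on {0..2*pi} \<phi>" "bounded_linear L"
  shows "circle_avg (\<lambda>\<theta>. L (\<phi> \<theta>)) = L (circle_avg \<phi>)"
proof -
  interpret L: bounded_linear L by fact
  have "integral {0..2*pi} (L \<circ> \<phi>) = L (integral {0..2*pi} \<phi>)"
    by (intro integral_linear integrable_continuous_real assms)
  then show ?thesis by (simp add: circle_avg_def o_def L.scaleR)
qed

lemma circle_avg_mono:
  fixes \<phi> \<psi> :: "real \<Rightarrow> real"
  assumes "continuous_on {0..2*pi} \<phi>" "continuous_on {0..2*pi} \<psi>"
    and "\<And>\<theta>. \<theta> \<in> {0..2*pi} \<Longrightarrow> \<phi> \<theta> \<le> \<psi> \<theta>"
  shows "circle_avg \<phi> \<le> circle_avg \<psi>"
  using assms by (auto simp: circle_avg_def intro!: divide_right_mono integral_le integrable_continuous_real)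

lemma norm_circle_avg_le:
  fixes \<phi> :: "real \<Rightarrow> complex"
  assumes "continuous_on {0..2*pi} \<phi>" "continuous_on {0..2*pi} \<psi>"
    and "\<And>\<theta>. \<theta> \<in> {0..2*pi} \<Longrightarrow> norm (\<phi> \<theta>) \<le> \<psi> \<theta>"
  shows "norm (circle_avg \<phi>) \<le> circle_avg \<psi>"
  using assms unfolding circle_avg_def
  by (auto intro!: divide_right_mono integral_norm_bound_integral integrable_continuous_real)

lemma circle_avg_sums:
  fixes u :: "nat \<Rightarrow> real \<Rightarrow> complex"
  assumes "\<And>n. continuous_on {0..2*pi} (u n)"
    and "\<And>n \<theta>. \<theta> \<in> {0..2*pi} \<Longrightarrow> norm (u n \<theta>) \<le> M n" and "summable M"
    and "\<And>\<theta>. \<theta> \<in> {0..2*pi} \<Longrightarrow> (\<lambda>n. u n \<theta>) sums v \<theta>"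
  shows "(\<lambda>n. circle_avg (u n)) sums circle_avg v"
proof -
  have "uniform_limit {0..2*pi} (\<lambda>n \<theta>. \<Sum>i<n. u i \<theta>) (\<lambda>\<theta>. \<Sum>i. u i \<theta>) sequentially"
    by (rule Weierstrass_m_test) (use assms in auto)
  then have ul: "uniform_limit ({0..2*pi}) (\<lambda>n \<theta>. \<Sum>i<n. u i \<theta>) v sequentially"
    using assms(4) by (subst uniform_limit_cong'[where g = "\<lambda>n \<theta>. \<Sum>i<n. u i \<theta>"]) (auto simp: sums_iff)
  obtain I J where IJ: "\<And>n. ((\<lambda>\<theta>. \<Sum>i<n. u i \<theta>) has_integral I n) ({0..2*pi})"
    "(v has_integral J) ({0..2*pi})" "(I \<longlongrightarrow> J) sequentially"
    using uniform_limit_integral[OF ul] assms(1) by (auto intro!: continuous_on_sum)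
  have "I = (\<lambda>n. \<Sum>i<n. integral {0..2*pi} (u i))"
    using integral_unique[OF IJ(1)] assms(1)
    by (simp add: fun_eq_iff integral_sum integrable_continuous_real)
  then have "(\<lambda>i. integral {0..2*pi} (u i)) sums integral {0..2*pi} v"
    using IJ(3) integral_unique[OF IJ(2)] by (simp add: sums_def)
  then show ?thesis unfolding circle_avg_def by (rule sums_scaleR_right)
qed

lemma cis_minus_nonzero: "norm z < 1 \<Longrightarrow> cis \<theta> - z \<noteq> 0" "norm z < 1 \<Longrightarrow> 1 - cnj z * cis \<theta> \<noteq> 0"
proof -
  assume z: "norm z < 1"
  show "cis \<theta> - z \<noteq> 0" using z by (metis eq_iff_diff_eq_0 norm_cis order_less_irrefl)
  have "norm (cnj z * cis \<theta>) < 1" using z by (simp add: norm_mult)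
  then show "1 - cnj z * cis \<theta> \<noteq> 0" by (metis eq_iff_diff_eq_0 norm_one order_less_irrefl)
qed

lemma Cauchy_integral_circle_avg:
  assumes "continuous_on (cball 0 1) G" "G holomorphic_on ball 0 1" "norm z < 1"
  shows "circle_avg (\<lambda>\<theta>. G (cis \<theta>) * (cis \<theta> / (cis \<theta> - z))) = G z"
proof -
  have "((\<lambda>u. G u / (u - z)) has_contour_integral 2 * of_real pi * \<i> * G z) (part_circlepath 0 1 0 (2 * pi))"
    using Cauchy_integral_circlepath[of 0 1 G z] assms by (simp add: circlepath_def)
  then have "((\<lambda>\<theta>. G (cis \<theta>) / (cis \<theta> - z) * \<i> * cis \<theta>) has_integral 2 * of_real pi * \<i> * G z) {0..2 * pi}"
    by (subst (asm) has_contour_integral_part_circlepath_iff) auto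
  then have "((\<lambda>\<theta>. (- \<i>) * (G (cis \<theta>) / (cis \<theta> - z) * \<i> * cis \<theta>)) has_integral
      (- \<i>) * (2 * of_real pi * \<i> * G z)) {0..2 * pi}"
    by (rule has_integral_mult_right)
  moreover have "(- \<i>) * (X / d * \<i> * c) = X * (c / d)" for X d c :: complex
  proof -
    have "(- \<i>) * (X / d * \<i> * c) = - (\<i> * \<i>) * (X * (c / d))"
      by (simp only: times_divide_eq_left times_divide_eq_right mult_ac mult_minus_left mult_minus_right)
    then show ?thesis by simp
  qed
  moreover have "(- \<i>) * (2 * of_real pi * \<i> * G z) = 2 * of_real pi * G z"
  proof -
    have "(- \<i>) * (2 * of_real pi * \<i> * G z) = - (\<i> * \<i>) * (2 * of_real pi * G z)"
      by (simp only: mult_ac mult_minus_left mult_minus_right)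
    then show ?thesis by simp
  qed
  ultimately have "((\<lambda>\<theta>. G (cis \<theta>) * (cis \<theta> / (cis \<theta> - z))) has_integral 2 * of_real pi * G z) {0..2 * pi}"
    by (simp only:)
  then show ?thesis
    by (simp add: circle_avg_def integral_unique scaleR_conv_of_real)
qed

lemma holomorphic_mean_value:
  assumes "continuous_on (cball 0 1) G" "G holomorphic_on ball 0 1"
  shows "circle_avg (\<lambda>\<theta>. G (cis \<theta>)) = G 0"
  using Cauchy_integral_circle_avg[OF assms, of 0] by simp

lemma holomorphic_mean_value_inside:
  assumes G: "G holomorphic_on ball 0 1" and z: "norm z < 1"
  shows "circle_avg (\<lambda>\<theta>. G (z * cis \<theta>)) = G 0"
proof -
  have m: "(\<lambda>w. z * w) ` cball 0 1 \<subseteq> ball 0 1"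
  proof clarsimp
    fix w :: complex assume "norm w \<le> 1"
    then have "norm z * norm w \<le> norm z * 1" by (intro mult_left_mono) auto
    then show "norm (z * w) < 1" using z by (simp add: norm_mult)
  qed
  have "(\<lambda>w. G (z * w)) holomorphic_on cball 0 1"
    using holomorphic_on_compose_gen[OF _ G m] by (auto intro!: holomorphic_intros simp: o_def)
  then have "circle_avg (\<lambda>\<theta>. G (z * cis \<theta>)) = G (z * 0)"
    by (intro holomorphic_mean_value)
      (auto intro: holomorphic_on_imp_continuous_on holomorphic_on_subset)
  then show ?thesis by simp
qed

definition poisson_kernel :: "complex \<Rightarrow> real \<Rightarrow> real" where
  "poisson_kernel z \<theta> = Re ((cis \<theta> + z) / (cis \<theta> - z))"

lemma continuous_on_poisson_kernel [continuous_intros]: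
  "norm z < 1 \<Longrightarrow> continuous_on S (poisson_kernel z)"
  unfolding poisson_kernel_def by (intro continuous_intros) (use cis_minus_nonzero in auto)

lemma poisson_kernel_pos:
  assumes "norm z < 1"
  shows "0 < poisson_kernel z \<theta>"
proof -
  have "Re ((cis \<theta> + z) * cnj (cis \<theta> - z)) = (norm (cis \<theta>))\<^sup>2 - (norm z)\<^sup>2"
    unfolding cmod_power2 by (simp add: algebra_simps power2_eq_square)
  also have "\<dots> > 0" using assms by (simp add: power_less_one_iff abs_square_less_1)
  finally have "0 < Re ((cis \<theta> + z) * cnj (cis \<theta> - z)) / (norm (cis \<theta> - z))\<^sup>2"
    using cis_minus_nonzero(1)[OF assms, of \<theta>] by (intro divide_pos_pos) auto
  also have "\<dots> = poisson_kernel z \<theta>"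
    unfolding poisson_kernel_def complex_div_cnj[of "cis \<theta> + z"]
    by (simp only: Re_divide_of_real of_real_power[symmetric])
  finally show ?thesis .
qed

text \<open>
On the unit circle conjugation is inversion, which makes the Poisson kernel the sum of the Cauchy
kernel and of a function holomorphic in the closed disk and vanishing at the origin.
\<close>

lemma poisson_kernel_split:
  assumes "norm z < 1"
  shows "complex_of_real (poisson_kernel z \<theta>) =
    cis \<theta> / (cis \<theta> - z) + cnj z * cis \<theta> / (1 - cnj z * cis \<theta>)"
proof -
  note nz = cis_minus_nonzero[OF assms, of \<theta>]
  have u: "cis \<theta> * cnj (cis \<theta>) = 1" by (simp add: cis_cnj cis_mult)
  have "cnj ((cis \<theta> + z) / (cis \<theta> - z)) = (1 + cnj z * cis \<theta>) / (1 - cnj z * cis \<theta>)"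
  proof -
    have "cnj ((cis \<theta> + z) / (cis \<theta> - z)) = (cis \<theta> * (cnj (cis \<theta>) + cnj z)) / (cis \<theta> * (cnj (cis \<theta>) - cnj z))"
      by simp
    then show ?thesis unfolding distrib_left right_diff_distrib u by (simp add: mult.commute)
  qed
  moreover have "complex_of_real (poisson_kernel z \<theta>)
     = ((cis \<theta> + z) / (cis \<theta> - z) + cnj ((cis \<theta> + z) / (cis \<theta> - z))) / 2"
    unfolding poisson_kernel_def complex_add_cnj by simp
  moreover have "(cis \<theta> + z) / (cis \<theta> - z) = 2 * (cis \<theta> / (cis \<theta> - z)) - 1"
    "(1 + cnj z * cis \<theta>) / (1 - cnj z * cis \<theta>) = 2 * (cnj z * cis \<theta> / (1 - cnj z * cis \<theta>)) + 1"
    using nz by (simp_all add: divide_simps)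
  moreover have "(2 * a - 1 + (2 * b + 1)) / 2 = a + b" for a b :: complex by simp
  ultimately show ?thesis by (simp only:)
qed

lemma Poisson_formula_holomorphic:
  assumes G: "continuous_on (cball 0 1) G" "G holomorphic_on ball 0 1" and z: "norm z < 1"
  shows "circle_avg (\<lambda>\<theta>. G (cis \<theta>) * poisson_kernel z \<theta>) = G z"
proof -
  have c: "continuous_on {0..2*pi} (\<lambda>\<theta>. G (cis \<theta>))"
    by (rule continuous_on_compose2[OF G(1)]) (auto intro!: continuous_intros)
  have nz: "cnj z * w \<noteq> 1" if "norm w \<le> 1" for w
  proof -
    have "norm (cnj z) * norm w \<le> norm (cnj z) * 1" using that by (intro mult_left_mono) auto
    then have "norm (cnj z * w) < 1" using z by (simp add: norm_mult)
    then show ?thesis by (metis norm_one order_less_irrefl)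
  qed
  \<comment> \<open>The second part of the kernel contributes nothing, as \<open>H 0 = 0\<close>.\<close>
  define H where "H = (\<lambda>w. G w * (cnj z * w / (1 - cnj z * w)))"
  have "circle_avg (\<lambda>\<theta>. H (cis \<theta>)) = H 0"
    unfolding H_def
    by (intro holomorphic_mean_value continuous_intros holomorphic_intros G) (auto simp: nz)
  then have "circle_avg (\<lambda>\<theta>. H (cis \<theta>)) = 0" by (simp add: H_def)
  moreover have "circle_avg (\<lambda>\<theta>. G (cis \<theta>) * (cis \<theta> / (cis \<theta> - z))) = G z"
    by (rule Cauchy_integral_circle_avg[OF G z])
  moreover have "circle_avg (\<lambda>\<theta>. G (cis \<theta>) * poisson_kernel z \<theta>)
     = circle_avg (\<lambda>\<theta>. G (cis \<theta>) * (cis \<theta> / (cis \<theta> - z)) + H (cis \<theta>))"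
    by (rule circle_avg_cong) (simp add: poisson_kernel_split[OF z] H_def distrib_left)
  moreover have "\<dots> = circle_avg (\<lambda>\<theta>. G (cis \<theta>) * (cis \<theta> / (cis \<theta> - z))) + circle_avg (\<lambda>\<theta>. H (cis \<theta>))"
    unfolding H_def
    by (intro circle_avg_add continuous_intros c) (use cis_minus_nonzero[OF z] in auto)
  ultimately show ?thesis by simp
qed

lemma circle_avg_poisson_kernel:
  assumes "norm z < 1"
  shows "circle_avg (poisson_kernel z) = 1"
proof -
  have "complex_of_real (circle_avg (poisson_kernel z)) = circle_avg (\<lambda>\<theta>. complex_of_real (poisson_kernel z \<theta>))"
    by (rule circle_avg_linear[symmetric, OF _ bounded_linear_of_real])
       (intro continuous_intros assms)
  also have "\<dots> = 1" using Poisson_formula_holomorphic[of "\<lambda>_. 1" z] assms by simp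
  finally show ?thesis by simp
qed

lemma Poisson_formula_harmonic:
  assumes G: "continuous_on (cball 0 1) G" "G holomorphic_on ball 0 1"
    and H: "continuous_on (cball 0 1) H" "H holomorphic_on ball 0 1" and z: "norm z < 1"
  shows "circle_avg (\<lambda>\<theta>. (G (cis \<theta>) + cnj (H (cis \<theta>))) * poisson_kernel z \<theta>) = G z + cnj (H z)"
proof -
  have c: "continuous_on {0..2*pi} (\<lambda>\<theta>. G (cis \<theta>))" "continuous_on {0..2*pi} (\<lambda>\<theta>. H (cis \<theta>))"
    by (rule continuous_on_compose2[OF G(1)] continuous_on_compose2[OF H(1)]; auto intro!: continuous_intros)+
  have "circle_avg (\<lambda>\<theta>. (G (cis \<theta>) + cnj (H (cis \<theta>))) * poisson_kernel z \<theta>)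
    = circle_avg (\<lambda>\<theta>. G (cis \<theta>) * poisson_kernel z \<theta> + cnj (H (cis \<theta>) * poisson_kernel z \<theta>))"
    by (rule circle_avg_cong) (simp add: distrib_right)
  also have "\<dots> = circle_avg (\<lambda>\<theta>. G (cis \<theta>) * poisson_kernel z \<theta>)
      + circle_avg (\<lambda>\<theta>. cnj (H (cis \<theta>) * poisson_kernel z \<theta>))"
    by (intro circle_avg_add continuous_intros c z)
  also have "circle_avg (\<lambda>\<theta>. cnj (H (cis \<theta>) * poisson_kernel z \<theta>))
      = cnj (circle_avg (\<lambda>\<theta>. H (cis \<theta>) * poisson_kernel z \<theta>))"
    by (rule circle_avg_linear[OF _ bounded_linear_cnj]) (intro continuous_intros c z)
  finally show ?thesis by (simp add: Poisson_formula_holomorphic assms)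
qed

text \<open>
The Herglotz integral of \<open>F\<close>: the holomorphic function whose real part is the Poisson integral of
\<open>F\<close> and which is real at the origin.
\<close>

definition herglotz :: "(real \<Rightarrow> real) \<Rightarrow> complex \<Rightarrow> complex" where
  "herglotz F z = circle_avg (\<lambda>\<theta>. F \<theta> * ((cis \<theta> + z) / (cis \<theta> - z)))"

lemma holomorphic_herglotz:
  assumes F: "continuous_on {0..2*pi} F"
  shows "herglotz F holomorphic_on ball 0 1"
proof -
  have "(\<lambda>z. integral (cbox 0 (2*pi)) (\<lambda>\<theta>. F \<theta> * ((cis \<theta> + z) / (cis \<theta> - z)))) holomorphic_on ball 0 1"
  proof (rule leibniz_rule_holomorphic[where fx = "\<lambda>z \<theta>. F \<theta> * (2 * cis \<theta> / (cis \<theta> - z)\<^sup>2)"])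
    fix z :: complex and \<theta> :: real
    assume z: "z \<in> ball 0 1"
    then have nz: "cis \<theta> - z \<noteq> 0" using cis_minus_nonzero by simp
    have "((\<lambda>z. (cis \<theta> + z) / (cis \<theta> - z)) has_field_derivative
        ((0 + 1) * (cis \<theta> - z) - (cis \<theta> + z) * (0 - 1)) / ((cis \<theta> - z) * (cis \<theta> - z))) (at z within ball 0 1)"
      by (intro DERIV_divide DERIV_add DERIV_diff DERIV_const DERIV_ident nz)
    then have "((\<lambda>z. (cis \<theta> + z) / (cis \<theta> - z)) has_field_derivative 2 * cis \<theta> / (cis \<theta> - z)\<^sup>2)
        (at z within ball 0 1)"
      by (rule DERIV_cong) (simp add: power2_eq_square)
    then show "((\<lambda>z. F \<theta> * ((cis \<theta> + z) / (cis \<theta> - z))) has_field_derivative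
         F \<theta> * (2 * cis \<theta> / (cis \<theta> - z)\<^sup>2)) (at z within ball 0 1)"
      by (rule DERIV_cmult)
  next
    fix z :: complex assume "z \<in> ball 0 1"
    then show "(\<lambda>\<theta>. F \<theta> * ((cis \<theta> + z) / (cis \<theta> - z))) integrable_on cbox 0 (2*pi)"
      using F cis_minus_nonzero by (auto intro!: integrable_continuous_real continuous_intros)
  next
    have "continuous_on (ball 0 1 \<times> cbox 0 (2*pi)) (\<lambda>x. F (snd x))" 
      by (rule continuous_on_compose2[OF F]) (auto intro!: continuous_intros)
    then show "continuous_on (ball (0::complex) 1 \<times> cbox 0 (2*pi))
        (\<lambda>(z, \<theta>). F \<theta> * (2 * cis \<theta> / (cis \<theta> - z)\<^sup>2))"
      unfolding case_prod_beta using cis_minus_nonzero by (auto intro!: continuous_intros)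
  qed auto
  then have "(\<lambda>z. of_real (1 / (2 * pi)) * integral (cbox 0 (2*pi)) (\<lambda>\<theta>. F \<theta> * ((cis \<theta> + z) / (cis \<theta> - z))))
      holomorphic_on ball 0 1"
    by (intro holomorphic_intros)
  then show ?thesis unfolding herglotz_def circle_avg_def scaleR_conv_of_real cbox_interval .
qed

lemma Re_herglotz:
  assumes F: "continuous_on {0..2*pi} F" and z: "norm z < 1"
  shows "Re (herglotz F z) = circle_avg (\<lambda>\<theta>. F \<theta> * poisson_kernel z \<theta>)"
proof -
  have "Re (herglotz F z) = circle_avg (\<lambda>\<theta>. Re (F \<theta> * ((cis \<theta> + z) / (cis \<theta> - z))))"
    unfolding herglotz_def
    by (rule circle_avg_linear[symmetric, OF _ bounded_linear_Re])
       (use F cis_minus_nonzero[OF z] in \<open>auto intro!: continuous_intros\<close>)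
  then show ?thesis by (simp add: poisson_kernel_def del: times_divide_eq_right)
qed

lemma herglotz_0:
  assumes F: "continuous_on {0..2*pi} F"
  shows "herglotz F 0 = of_real (circle_avg F)"
proof -
  have "herglotz F 0 = circle_avg (\<lambda>\<theta>. complex_of_real (F \<theta>))" by (simp add: herglotz_def)
  also have "\<dots> = of_real (circle_avg F)"
    by (rule circle_avg_linear[OF F bounded_linear_of_real])
  finally show ?thesis .
qed

section \<open>Parseval and Carleman inequalities\<close>

lemma continuous_on_circle:
  assumes "continuous_on (ball 0 1) G" "norm z < 1"
  shows "continuous_on S (\<lambda>\<theta>. G (z * cis \<theta>))"
  by (rule continuous_on_compose2[OF assms(1)])
     (use assms(2) in \<open>auto intro!: continuous_intros simp: norm_mult\<close>)

lemma circle_avg_monomials: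
  assumes "norm z < 1"
  shows "circle_avg (\<lambda>\<theta>. (z * cis \<theta>) ^ n * cnj ((z * cis \<theta>) ^ m))
    = (if n = m then of_real (norm z ^ (2 * m)) else 0)"
proof -
  have mv: "circle_avg (\<lambda>\<theta>. (z * cis \<theta>) ^ k) = 0 ^ k" for k
    using holomorphic_mean_value_inside[OF holomorphic_on_power[OF holomorphic_on_ident] assms] .
  have mod: "(z * cis \<theta>) ^ j * cnj ((z * cis \<theta>) ^ j) = of_real (norm z ^ (2 * j))" for j \<theta>
    unfolding complex_norm_square[symmetric] by (simp add: norm_power norm_mult power_even_eq power_mult_distrib)
  \<comment> \<open>The mean value property of \<open>w ^ k\<close> replaces an explicit integration of exponentials.\<close>
  have ge: "circle_avg (\<lambda>\<theta>. (z * cis \<theta>) ^ (j + k) * cnj ((z * cis \<theta>) ^ j)) = of_real (norm z ^ (2 * j)) * 0 ^ k" for j k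
  proof -
    have "(z * cis \<theta>) ^ (j + k) * cnj ((z * cis \<theta>) ^ j) = of_real (norm z ^ (2 * j)) * (z * cis \<theta>) ^ k" for \<theta>
    proof -
      have "(z * cis \<theta>) ^ (j + k) * cnj ((z * cis \<theta>) ^ j)
          = ((z * cis \<theta>) ^ j * cnj ((z * cis \<theta>) ^ j)) * (z * cis \<theta>) ^ k"
        by (simp only: power_add mult_ac)
      then show ?thesis by (simp only: mod)
    qed
    then show ?thesis
      by (simp only: mv[symmetric]) (intro circle_avg_mult_left continuous_intros)
  qed
  show ?thesis
  proof (cases "m \<le> n")
    case True
    then show ?thesis using ge[of m "n - m"] by auto
  next
    case False
    have "circle_avg (\<lambda>\<theta>. (z * cis \<theta>) ^ n * cnj ((z * cis \<theta>) ^ m))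
       = circle_avg (\<lambda>\<theta>. cnj ((z * cis \<theta>) ^ m * cnj ((z * cis \<theta>) ^ n)))"
      by (intro circle_avg_cong) (simp add: mult.commute)
    also have "\<dots> = cnj (circle_avg (\<lambda>\<theta>. (z * cis \<theta>) ^ m * cnj ((z * cis \<theta>) ^ n)))"
      by (rule circle_avg_linear[OF _ bounded_linear_cnj]) (intro continuous_intros)
    finally show ?thesis using ge[of n "m - n"] False by simp
  qed
qed

text \<open>
The circle is parametrised as \<open>z * cis \<theta>\<close> with complex \<open>z\<close>, because the averages over rotated
points of the disk have this shape.  The double series is avoided: first the average of \<open>G\<close> against
one conjugate monomial picks out one coefficient, then \<open>cnj G\<close> alone is expanded.
\<close>

lemma Parseval_circle:
  fixes a :: "nat \<Rightarrow> complex"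
  assumes G: "G holomorphic_on ball 0 1"
    and a: "\<And>w. norm w < 1 \<Longrightarrow> (\<lambda>n. a n * w ^ n) sums G w" and z: "norm z < 1"
  shows "(\<lambda>n. (norm (a n))\<^sup>2 * norm z ^ (2 * n)) sums circle_avg (\<lambda>\<theta>. (norm (G (z * cis \<theta>)))\<^sup>2)"
proof -
  have nz: "norm (z * cis \<theta>) = norm z" for \<theta> by (simp add: norm_mult)
  have sm: "summable (\<lambda>n. norm (a n) * norm z ^ n)"
  proof -
    \<comment> \<open>Convergence at the point \<open>x\<close> farther out gives absolute convergence at \<open>z\<close>.\<close>
    define x where "x = complex_of_real ((1 + norm z) / 2)"
    have nx: "norm x = (1 + norm z) / 2" unfolding x_def norm_of_real by simp
    then have "summable (\<lambda>n. a n * x ^ n)" using a[of x] z by (simp add: sums_iff)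
    then have "summable (\<lambda>n. norm (a n * z ^ n))"
      by (rule powser_insidea) (use nx z in simp)
    then show ?thesis by (simp add: norm_mult norm_power)
  qed
  have cG: "continuous_on S (\<lambda>\<theta>. G (z * cis \<theta>))" for S
    using continuous_on_circle[OF holomorphic_on_imp_continuous_on[OF G] z] .
  have coeff: "circle_avg (\<lambda>\<theta>. G (z * cis \<theta>) * cnj ((z * cis \<theta>) ^ m)) = a m * of_real (norm z ^ (2 * m))" for m
  proof -
    have "(\<lambda>n. circle_avg (\<lambda>\<theta>. a n * (z * cis \<theta>) ^ n * cnj ((z * cis \<theta>) ^ m)))
       sums circle_avg (\<lambda>\<theta>. G (z * cis \<theta>) * cnj ((z * cis \<theta>) ^ m))"
    proof (rule circle_avg_sums[OF _ _ sm])
      show "norm (a n * (z * cis \<theta>) ^ n * cnj ((z * cis \<theta>) ^ m)) \<le> norm (a n) * norm z ^ n" for n \<theta>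
      proof -
        have "norm (a n) * norm z ^ n * norm z ^ m \<le> norm (a n) * norm z ^ n * 1"
          using z by (intro mult_left_mono power_le_one) auto
        then show ?thesis by (simp add: norm_mult norm_power)
      qed
      show "(\<lambda>n. a n * (z * cis \<theta>) ^ n * cnj ((z * cis \<theta>) ^ m)) sums (G (z * cis \<theta>) * cnj ((z * cis \<theta>) ^ m))" for \<theta>
        by (intro sums_mult2 a) (use nz z in simp)
    qed (intro continuous_intros)
    moreover have "circle_avg (\<lambda>\<theta>. a n * (z * cis \<theta>) ^ n * cnj ((z * cis \<theta>) ^ m))
        = (if n = m then a n * of_real (norm z ^ (2 * n)) else 0)" for n
    proof -
      have "circle_avg (\<lambda>\<theta>. a n * ((z * cis \<theta>) ^ n * cnj ((z * cis \<theta>) ^ m)))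
         = a n * (if n = m then of_real (norm z ^ (2 * m)) else 0)"
        unfolding circle_avg_monomials[OF z, symmetric]
        by (intro circle_avg_mult_left continuous_intros)
      then show ?thesis by (simp add: mult.assoc)
    qed
    ultimately show ?thesis
      using sums_unique2[OF _ sums_single[of m "\<lambda>n. a n * of_real (norm z ^ (2 * n))"]] by simp
  qed
  obtain B where B: "\<And>\<theta>. \<theta> \<in> {0..2*pi} \<Longrightarrow> norm (G (z * cis \<theta>)) \<le> B"
  proof -
    have "compact ((\<lambda>\<theta>. G (z * cis \<theta>)) ` {0..2*pi})" by (intro compact_continuous_image cG) simp
    then show thesis using that by (metis bounded_iff compact_imp_bounded imageI)
  qed
  have "(\<lambda>m. circle_avg (\<lambda>\<theta>. G (z * cis \<theta>) * cnj (a m * (z * cis \<theta>) ^ m)))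
     sums circle_avg (\<lambda>\<theta>. G (z * cis \<theta>) * cnj (G (z * cis \<theta>)))"
  proof (rule circle_avg_sums[OF _ _ summable_mult[OF sm, of B]])
    show "norm (G (z * cis \<theta>) * cnj (a m * (z * cis \<theta>) ^ m)) \<le> B * (norm (a m) * norm z ^ m)"
      if "\<theta> \<in> {0..2*pi}" for m \<theta>
      unfolding norm_mult complex_mod_cnj norm_power norm_cis mult_1_right
      by (intro mult_right_mono B that) simp
    show "(\<lambda>m. G (z * cis \<theta>) * cnj (a m * (z * cis \<theta>) ^ m)) sums (G (z * cis \<theta>) * cnj (G (z * cis \<theta>)))" for \<theta>
      by (intro sums_mult sums_cnj[THEN iffD2] a) (use nz z in simp)
  qed (intro continuous_intros cG)
  moreover have "circle_avg (\<lambda>\<theta>. G (z * cis \<theta>) * cnj (a m * (z * cis \<theta>) ^ m))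
     = of_real ((norm (a m))\<^sup>2 * norm z ^ (2 * m))" for m
  proof -
    have "circle_avg (\<lambda>\<theta>. G (z * cis \<theta>) * cnj (a m * (z * cis \<theta>) ^ m))
      = circle_avg (\<lambda>\<theta>. cnj (a m) * (G (z * cis \<theta>) * cnj ((z * cis \<theta>) ^ m)))"
      by (intro circle_avg_cong) (simp add: mult_ac)
    also have "\<dots> = cnj (a m) * (a m * of_real (norm z ^ (2 * m)))"
      unfolding coeff[symmetric] by (intro circle_avg_mult_left continuous_intros cG)
    also have "\<dots> = (a m * cnj (a m)) * of_real (norm z ^ (2 * m))" by (simp only: mult_ac)
    finally show ?thesis unfolding complex_norm_square[symmetric] of_real_mult .
  qed
  moreover have "circle_avg (\<lambda>\<theta>. G (z * cis \<theta>) * cnj (G (z * cis \<theta>)))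
     = of_real (circle_avg (\<lambda>\<theta>. (norm (G (z * cis \<theta>)))\<^sup>2))"
    unfolding complex_norm_square[symmetric]
    by (rule circle_avg_linear[OF _ bounded_linear_of_real]) (intro continuous_intros cG)
  ultimately show ?thesis by (simp only: sums_of_real_iff)
qed

text \<open>
The square integrability of boundary values, without boundary values: each partial sum is a
continuous function of the radius, so the bound persists at radius 1.
\<close>

lemma summable_norm_square_coeffs:
  fixes a :: "nat \<Rightarrow> complex"
  assumes "\<And>r. 0 < r \<Longrightarrow> r < 1 \<Longrightarrow> summable (\<lambda>n. (norm (a n))\<^sup>2 * r ^ (2 * n))"
    and "\<And>r. 0 < r \<Longrightarrow> r < 1 \<Longrightarrow> (\<Sum>n. (norm (a n))\<^sup>2 * r ^ (2 * n)) \<le> M"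
  shows "summable (\<lambda>n. (norm (a n))\<^sup>2)" "(\<Sum>n. (norm (a n))\<^sup>2) \<le> M"
proof -
  have le: "(\<Sum>n<N. (norm (a n))\<^sup>2) \<le> M" for N
  proof (rule tendsto_upperbound)
    show "((\<lambda>r::real. \<Sum>n<N. (norm (a n))\<^sup>2 * r ^ (2 * n)) \<longlongrightarrow> (\<Sum>n<N. (norm (a n))\<^sup>2)) (at_left 1)"
      by (rule tendsto_eq_intros refl | simp)+
    have "eventually (\<lambda>r::real. 0 < r \<and> r < 1) (at_left 1)"
      using eventually_at_left_real[of 0 1] by simp
    then show "\<forall>\<^sub>F r::real in at_left 1. (\<Sum>n<N. (norm (a n))\<^sup>2 * r ^ (2 * n)) \<le> M"
    proof eventually_elim
      case (elim r)
      then show ?case using assms[of r] sum_le_suminf[OF assms(1)[of r], of "{..<N}"] by auto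
    qed
  qed simp
  show s: "summable (\<lambda>n. (norm (a n))\<^sup>2)"
    by (rule summableI_nonneg_bounded[OF _ le]) simp
  show "(\<Sum>n. (norm (a n))\<^sup>2) \<le> M" by (rule suminf_le_const[OF s le])
qed

text \<open>
Carleman's inequality on the level of coefficients.  By Cauchy-Schwarz,
\<open>(norm (b n))\<^sup>2 / (n + 1)\<close> is at most the convolution of the sequence \<open>(norm (a i))\<^sup>2\<close> with itself,
whose sum is the square of the sum of that sequence.
\<close>

lemma sum_square_convolution_le:
  fixes a :: "nat \<Rightarrow> complex"
  assumes s: "summable (\<lambda>n. (norm (a n))\<^sup>2)"
  defines "b \<equiv> \<lambda>n. \<Sum>i\<le>n. a i * a (n - i)"
  shows "summable (\<lambda>n. (norm (b n))\<^sup>2 / (n + 1))"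
    "(\<Sum>n. (norm (b n))\<^sup>2 / (n + 1)) \<le> (\<Sum>n. (norm (a n))\<^sup>2)\<^sup>2"
proof -
  define c where "c = (\<lambda>n. \<Sum>i\<le>n. (norm (a i))\<^sup>2 * (norm (a (n - i)))\<^sup>2)"
  have c: "c sums ((\<Sum>n. (norm (a n))\<^sup>2) * (\<Sum>n. (norm (a n))\<^sup>2))"
    unfolding c_def by (rule Cauchy_product_sums) (use s in auto)
  have le: "(norm (b n))\<^sup>2 / (n + 1) \<le> c n" for n
  proof -
    have "(norm (b n))\<^sup>2 \<le> (\<Sum>i\<le>n. norm (a i * a (n - i)))\<^sup>2"
      unfolding b_def by (intro power_mono norm_sum) auto
    also have "\<dots> \<le> (\<Sum>i\<le>n. (norm (a i * a (n - i)))\<^sup>2) * card {..n}"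
      by (rule sum_squared_le_sum_of_squares)
    also have "\<dots> = c n * (n + 1)" by (simp add: c_def norm_mult power_mult_distrib)
    finally show ?thesis by (simp add: divide_le_eq)
  qed
  show sb: "summable (\<lambda>n. (norm (b n))\<^sup>2 / (n + 1))"
    by (rule summable_comparison_test'[OF sums_summable[OF c], of 0]) (use le in auto)
  have "(\<Sum>n. (norm (b n))\<^sup>2 / (n + 1)) \<le> suminf c"
    by (rule suminf_le[OF le sb sums_summable[OF c]])
  then show "(\<Sum>n. (norm (b n))\<^sup>2 / (n + 1)) \<le> (\<Sum>n. (norm (a n))\<^sup>2)\<^sup>2"
    using c by (simp add: sums_iff power2_eq_square)
qed

lemma nn_integral_circle_avg:
  assumes "continuous_on {0..2*pi} \<phi>" "\<And>\<theta>. \<theta> \<in> {0..2*pi} \<Longrightarrow> 0 \<le> \<phi> \<theta>"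
  shows "(\<integral>\<^sup>+\<theta>\<in>{0..2*pi}. ennreal (\<phi> \<theta>) \<partial>lborel) = ennreal (2 * pi * circle_avg \<phi>)"
proof -
  have I: "(\<phi> has_integral integral {0..2*pi} \<phi>) {0..2*pi}"
    by (intro integrable_integral integrable_continuous_real assms)
  have "(\<integral>\<^sup>+\<theta>. ennreal (indicator {0..2*pi} \<theta> * \<phi> \<theta>) \<partial>lborel) = ennreal (integral {0..2*pi} \<phi>)"
    by (rule nn_integral_has_integral_lebesgue[OF _ I]) (use assms in auto)
  moreover have "ennreal (\<phi> \<theta>) * indicator {0..2*pi} \<theta> = ennreal (indicator {0..2*pi} \<theta> * \<phi> \<theta>)" for \<theta>
    by (simp add: indicator_def)
  ultimately show ?thesis by (simp add: circle_avg_def)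
qed

text \<open>
Means over circles about the origin, bounded by a power series in the squared radius, are integrated
over the disk term by term.
\<close>

lemma nn_integral_disk_le_of_circle_avg:
  fixes \<Phi> :: "complex \<Rightarrow> real"
  assumes \<Phi>: "continuous_on (ball 0 1) \<Phi>" "\<And>z. norm z < 1 \<Longrightarrow> 0 \<le> \<Phi> z"
    and c: "\<And>n. 0 \<le> c n" "\<And>z::complex. norm z < 1 \<Longrightarrow> summable (\<lambda>n. c n * norm z ^ (2 * n))"
      "summable (\<lambda>n. c n / (n + 1))"
    and AD: "0 \<le> A" "0 \<le> D"
    and le: "\<And>z. norm z < 1 \<Longrightarrow> circle_avg (\<lambda>\<theta>. \<Phi> (z * cis \<theta>)) \<le> A * (\<Sum>n. c n * norm z ^ (2 * n)) + D"
  shows "(\<integral>\<^sup>+z\<in>ball 0 1. ennreal (\<Phi> z) \<partial>lborel) \<le> ennreal (pi * (A * (\<Sum>n. c n / (n + 1)) + D))"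
proof -
  define S where "S = (\<Sum>n. c n / (n + 1))"
  have S0: "0 \<le> S" unfolding S_def by (intro suminf_nonneg c) (use c in auto)
  define \<phi> where "\<phi> = (\<lambda>z. ennreal (indicator (ball 0 1) z * \<Phi> z))"
  have [measurable]: "\<phi> \<in> borel_measurable borel"
    unfolding \<phi>_def using borel_measurable_continuous_on_indicator[OF _ \<Phi>(1)] by simp
  have [measurable]: "ball (0::complex) 1 \<in> sets borel" by simp
  have "ennreal (2 * pi) * (\<integral>\<^sup>+z\<in>ball 0 1. \<phi> z \<partial>lborel)
    = (\<integral>\<^sup>+z\<in>ball 0 1. (\<integral>\<^sup>+\<theta>\<in>{0..2*pi}. \<phi> (cis \<theta> * z) \<partial>lborel) \<partial>lborel)"
    by (rule nn_integral_disk_circle_average) simp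
  also have "\<dots> \<le> (\<integral>\<^sup>+z\<in>ball (0::complex) 1. ennreal (2 * pi) * (ennreal A * (\<Sum>n. ennreal (c n) * ennreal (norm z ^ (2 * n))) + ennreal D) \<partial>lborel)"
  proof (intro nn_integral_mono)
    fix z :: complex
    show "(\<integral>\<^sup>+\<theta>\<in>{0..2*pi}. \<phi> (cis \<theta> * z) \<partial>lborel) * indicator (ball 0 1) z
      \<le> ennreal (2 * pi) * (ennreal A * (\<Sum>n. ennreal (c n) * ennreal (norm z ^ (2 * n))) + ennreal D) * indicator (ball 0 1) z"
    proof (cases "norm z < 1")
      case True
      have "(\<integral>\<^sup>+\<theta>\<in>{0..2*pi}. \<phi> (cis \<theta> * z) \<partial>lborel) = (\<integral>\<^sup>+\<theta>\<in>{0..2*pi}. ennreal (\<Phi> (z * cis \<theta>)) \<partial>lborel)"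
        using True by (intro nn_integral_cong) (simp add: \<phi>_def norm_mult mult.commute)
      also have "\<dots> = ennreal (2 * pi * circle_avg (\<lambda>\<theta>. \<Phi> (z * cis \<theta>)))"
        using True by (intro nn_integral_circle_avg continuous_on_circle \<Phi>) (auto simp: norm_mult)
      also have "\<dots> \<le> ennreal (2 * pi * (A * (\<Sum>n. c n * norm z ^ (2 * n)) + D))"
        by (intro ennreal_leI mult_left_mono le True) auto
      also have "\<dots> = ennreal (2 * pi) * (ennreal A * ennreal (\<Sum>n. c n * norm z ^ (2 * n)) + ennreal D)"
      proof -
        have s0: "0 \<le> (\<Sum>n. c n * norm z ^ (2 * n))"
          using c True by (intro suminf_nonneg) auto
        then have "0 \<le> A * (\<Sum>n. c n * norm z ^ (2 * n))" using AD by simp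
        then show ?thesis using AD s0 by (simp add: ennreal_mult ennreal_plus)
      qed
      also have "ennreal (\<Sum>n. c n * norm z ^ (2 * n)) = (\<Sum>n. ennreal (c n) * ennreal (norm z ^ (2 * n)))"
        using c True by (subst suminf_ennreal2[symmetric]) (auto simp: ennreal_mult)
      finally show ?thesis using True by simp
    qed simp
  qed
  also have "\<dots> = ennreal (2 * pi) * (ennreal A * (\<Sum>n. ennreal (c n) * (\<integral>\<^sup>+z\<in>ball (0::complex) 1. ennreal (norm z ^ (2 * n)) \<partial>lborel))
      + ennreal D * emeasure lborel (ball (0::complex) 1))"
  proof -
    have "(\<integral>\<^sup>+z\<in>ball (0::complex) 1. ennreal (2 * pi) * (ennreal A * (\<Sum>n. ennreal (c n) * ennreal (norm z ^ (2 * n))) + ennreal D) \<partial>lborel)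
      = (\<integral>\<^sup>+z. ennreal (2 * pi) * (ennreal A * (\<Sum>n. ennreal (c n) * (ennreal (norm z ^ (2 * n)) * indicator (ball (0::complex) 1) z))
          + ennreal D * indicator (ball 0 1) z) \<partial>lborel)"
      by (intro nn_integral_cong) (simp add: indicator_def)
    also have "\<dots> = ennreal (2 * pi) * (ennreal A * (\<Sum>n. ennreal (c n) * (\<integral>\<^sup>+z\<in>ball (0::complex) 1. ennreal (norm z ^ (2 * n)) \<partial>lborel))
      + ennreal D * emeasure lborel (ball (0::complex) 1))"
      by (simp add: nn_integral_cmult nn_integral_add nn_integral_suminf)
    finally show ?thesis .
  qed
  also have "emeasure lborel (ball (0::complex) 1) = ennreal pi"
    by (simp add: emeasure_ball unit_ball_vol_2)
  also have "(\<Sum>n. ennreal (c n) * (\<integral>\<^sup>+z\<in>ball (0::complex) 1. ennreal (norm z ^ (2 * n)) \<partial>lborel)) = ennreal (pi * S)"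
  proof -
    have "ennreal (c n) * ennreal (pi / (n + 1)) = ennreal (pi * (c n / (n + 1)))" for n
      using c by (subst ennreal_mult[symmetric]) (auto simp: mult_ac)
    then have "(\<Sum>n. ennreal (c n) * (\<integral>\<^sup>+z\<in>ball (0::complex) 1. ennreal (norm z ^ (2 * n)) \<partial>lborel))
       = (\<Sum>n. ennreal (pi * (c n / (n + 1))))"
      unfolding nn_integral_norm_power_disk by simp
    also have "\<dots> = ennreal (\<Sum>n. pi * (c n / (n + 1)))"
      using c by (intro suminf_ennreal2 summable_mult) auto
    finally show ?thesis using suminf_mult[OF c(3), of pi] by (simp add: S_def)
  qed
  also have "ennreal (2 * pi) * (ennreal A * ennreal (pi * S) + ennreal D * ennreal pi)
     = ennreal (2 * pi) * ennreal (pi * (A * S + D))"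
    using AD S0 by (simp add: ennreal_mult[symmetric] ennreal_plus[symmetric] algebra_simps del: ennreal_plus)
  finally have "(\<integral>\<^sup>+z\<in>ball 0 1. \<phi> z \<partial>lborel) \<le> ennreal (pi * (A * S + D))"
    by (subst (asm) ennreal_mult_le_mult_iff) auto
  also have "(\<integral>\<^sup>+z\<in>ball 0 1. \<phi> z \<partial>lborel) = (\<integral>\<^sup>+z\<in>ball 0 1. ennreal (\<Phi> z) \<partial>lborel)"
    by (intro nn_integral_cong) (simp add: \<phi>_def indicator_def)
  finally show ?thesis by (simp add: S_def)
qed

text \<open>
For \<open>\<Phi> = (\<lambda>z. norm (G z) ^ 4)\<close>, \<open>A = 1\<close> and \<open>D = 0\<close> this is Carleman's inequality: the area integral
of \<open>norm (G z) ^ 4\<close> is governed by the coefficients \<open>b n\<close> of \<open>G\<^sup>2\<close>, the weight \<open>1 / (n + 1)\<close> coming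
from the area integral of \<open>norm z ^ (2 * n)\<close>.  Integrating a function \<open>\<Phi>\<close> that is dominated only in
the mean over circles allows a pointwise estimate with an error of known mean value.
\<close>

lemma Carleman_inequality_majorant:
  fixes \<Phi> :: "complex \<Rightarrow> real"
  assumes G: "G holomorphic_on ball 0 1"
    and M: "\<And>z. norm z < 1 \<Longrightarrow> circle_avg (\<lambda>\<theta>. (norm (G (z * cis \<theta>)))\<^sup>2) \<le> M"
    and \<Phi>: "continuous_on (ball 0 1) \<Phi>" "\<And>z. norm z < 1 \<Longrightarrow> 0 \<le> \<Phi> z"
    and AD: "0 \<le> A" "0 \<le> D"
    and le: "\<And>z. norm z < 1 \<Longrightarrow>
      circle_avg (\<lambda>\<theta>. \<Phi> (z * cis \<theta>)) \<le> A * circle_avg (\<lambda>\<theta>. (norm (G (z * cis \<theta>))) ^ 4) + D"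
  shows "(\<integral>\<^sup>+z\<in>ball 0 1. ennreal (\<Phi> z) \<partial>lborel) \<le> ennreal (pi * (A * M\<^sup>2 + D))"
proof -
  define a where "a = (\<lambda>n. (deriv ^^ n) G 0 / fact n)"
  define b where "b = (\<lambda>n. \<Sum>i\<le>n. a i * a (n - i))"
  have a: "(\<lambda>n. a n * w ^ n) sums G w" if "norm w < 1" for w
    using holomorphic_power_series[OF G, of w] that by (simp add: a_def)
  have b: "(\<lambda>n. b n * w ^ n) sums (G w)\<^sup>2" if "norm w < 1" for w
  proof -
    \<comment> \<open>Convergence at the point \<open>x\<close> farther out gives absolute convergence at \<open>w\<close>.\<close>
    define x where "x = complex_of_real ((1 + norm w) / 2)"
    have nx: "norm x = (1 + norm w) / 2" unfolding x_def norm_of_real by simp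
    then have "summable (\<lambda>n. a n * x ^ n)" using a[of x] that by (simp add: sums_iff)
    then have s: "summable (\<lambda>n. norm (a n * w ^ n))"
      by (rule powser_insidea) (use nx that in simp)
    have "(\<lambda>n. \<Sum>i\<le>n. (a i * w ^ i) * (a (n - i) * w ^ (n - i))) sums ((\<Sum>n. a n * w ^ n) * (\<Sum>n. a n * w ^ n))"
      by (rule Cauchy_product_sums[OF s s])
    moreover have "(\<Sum>i\<le>n. (a i * w ^ i) * (a (n - i) * w ^ (n - i))) = b n * w ^ n" for n
      unfolding b_def sum_distrib_right
    proof (intro sum.cong refl)
      fix i assume "i \<in> {..n}"
      then have "w ^ n = w ^ i * w ^ (n - i)" by (simp flip: power_add)
      then show "a i * w ^ i * (a (n - i) * w ^ (n - i)) = a i * a (n - i) * w ^ n"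
        by (simp only: mult_ac)
    qed
    ultimately show ?thesis using a[OF that] by (simp add: sums_iff power2_eq_square)
  qed
  note Pa = Parseval_circle[OF G a]
  have G2: "(\<lambda>w. (G w)\<^sup>2) holomorphic_on ball 0 1" by (intro holomorphic_intros G)
  note Pb = Parseval_circle[OF G2 b]
  have A1: "summable (\<lambda>n. (norm (a n))\<^sup>2)" "(\<Sum>n. (norm (a n))\<^sup>2) \<le> M"
  proof -
    have *: "summable (\<lambda>n. (norm (a n))\<^sup>2 * r ^ (2 * n))" "(\<Sum>n. (norm (a n))\<^sup>2 * r ^ (2 * n)) \<le> M"
      if "0 < r" "r < 1" for r
      using Pa[of "complex_of_real r"] M[of "complex_of_real r"] that by (auto simp: sums_iff)
    show "summable (\<lambda>n. (norm (a n))\<^sup>2)" "(\<Sum>n. (norm (a n))\<^sup>2) \<le> M"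
      using summable_norm_square_coeffs[of a M] * by blast+
  qed
  have B: "summable (\<lambda>n. (norm (b n))\<^sup>2 / (n + 1))" "(\<Sum>n. (norm (b n))\<^sup>2 / (n + 1)) \<le> M\<^sup>2"
  proof -
    show "summable (\<lambda>n. (norm (b n))\<^sup>2 / (n + 1))"
      unfolding b_def by (rule sum_square_convolution_le[OF A1(1)])
    have "(\<Sum>n. (norm (b n))\<^sup>2 / (n + 1)) \<le> (\<Sum>n. (norm (a n))\<^sup>2)\<^sup>2"
      unfolding b_def by (rule sum_square_convolution_le[OF A1(1)])
    also have "\<dots> \<le> M\<^sup>2" by (intro power_mono A1 suminf_nonneg) auto
    finally show "(\<Sum>n. (norm (b n))\<^sup>2 / (n + 1)) \<le> M\<^sup>2" .
  qed
  have "(\<integral>\<^sup>+z\<in>ball 0 1. ennreal (\<Phi> z) \<partial>lborel)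
      \<le> ennreal (pi * (A * (\<Sum>n. (norm (b n))\<^sup>2 / (n + 1)) + D))"
  proof (rule nn_integral_disk_le_of_circle_avg[OF \<Phi> _ _ B(1) AD])
    fix z :: complex assume z: "norm z < 1"
    show "summable (\<lambda>n. (norm (b n))\<^sup>2 * norm z ^ (2 * n))" using Pb[OF _ z] by (simp add: sums_iff)
    have "circle_avg (\<lambda>\<theta>. (norm (G (z * cis \<theta>))) ^ 4) = (\<Sum>n. (norm (b n))\<^sup>2 * norm z ^ (2 * n))"
      using Pb[OF _ z] by (simp add: sums_iff norm_power flip: power_mult)
    then show "circle_avg (\<lambda>\<theta>. \<Phi> (z * cis \<theta>)) \<le> A * (\<Sum>n. (norm (b n))\<^sup>2 * norm z ^ (2 * n)) + D"
      using le[OF z] by simp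
  qed auto
  also have "\<dots> \<le> ennreal (pi * (A * M\<^sup>2 + D))"
    using B AD by (intro ennreal_leI mult_left_mono add_right_mono) auto
  finally show ?thesis .
qed

section \<open>The inequality for Poisson integrals of positive functions\<close>

lemma circle_avg_pos:
  fixes \<phi> :: "real \<Rightarrow> real"
  assumes "continuous_on {0..2*pi} \<phi>" "\<And>\<theta>. \<theta> \<in> {0..2*pi} \<Longrightarrow> 0 < \<phi> \<theta>"
  shows "0 < circle_avg \<phi>"
proof -
  obtain t where t: "t \<in> {0..2*pi}" "\<And>\<theta>. \<theta> \<in> {0..2*pi} \<Longrightarrow> \<phi> t \<le> \<phi> \<theta>"
    using continuous_attains_inf[OF _ _ assms(1)] by auto
  have "circle_avg (\<lambda>\<theta>. \<phi> t) \<le> circle_avg \<phi>" by (intro circle_avg_mono assms t) auto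
  then show ?thesis using assms(2)[OF t(1)] by simp
qed

lemma Re_herglotz_pos:
  assumes F: "continuous_on {0..2*pi} F" "\<And>\<theta>. \<theta> \<in> {0..2*pi} \<Longrightarrow> 0 < F \<theta>" and z: "norm z < 1"
  shows "0 < Re (herglotz F z)"
  unfolding Re_herglotz[OF F(1) z]
  by (intro circle_avg_pos continuous_intros F z mult_pos_pos poisson_kernel_pos)

lemma powr_tangent_le:
  fixes x y s :: real
  assumes "1 \<le> s" "0 < x" "0 < y"
  shows "y powr s + s * y powr (s - 1) * (x - y) \<le> x powr s"
proof -
  have "((\<lambda>x. x powr s) has_field_derivative s * y powr (s - 1)) (at y within {0<..})"
    using assms by (auto intro!: derivative_eq_intros)
  then have "s * y powr (s - 1) * (x - y) \<le> x powr s - y powr s"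
    using assms by (intro convex_on_imp_above_tangent[OF powr_convex[OF assms(1)]]) (auto simp: interior_open)
  then show ?thesis by simp
qed

text \<open>
Jensen's inequality for the probability density given by the Poisson kernel, obtained by
integrating the tangent line inequality at the point \<open>y\<close>.
\<close>

lemma Poisson_Jensen:
  assumes F: "continuous_on {0..2*pi} F" "\<And>\<theta>. \<theta> \<in> {0..2*pi} \<Longrightarrow> 0 < F \<theta>"
    and s: "1 \<le> s" and z: "norm z < 1"
  shows "Re (herglotz F z) powr s \<le> Re (herglotz (\<lambda>\<theta>. F \<theta> powr s) z)"
proof -
  have Fs: "continuous_on {0..2*pi} (\<lambda>\<theta>. F \<theta> powr s)"
    using F by (intro continuous_intros) (auto simp: less_imp_neq[symmetric])
  define y where "y = Re (herglotz F z)"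
  define k where "k = s * y powr (s - 1)"
  have y: "0 < y" unfolding y_def by (rule Re_herglotz_pos[OF F z])
  have c: "continuous_on {0..2*pi} (\<lambda>\<theta>. F \<theta> * poisson_kernel z \<theta>)"
    by (intro continuous_intros F z)
  have "circle_avg (\<lambda>\<theta>. (y powr s - k * y) * poisson_kernel z \<theta> + k * (F \<theta> * poisson_kernel z \<theta>))
      = circle_avg (\<lambda>\<theta>. (y powr s - k * y) * poisson_kernel z \<theta>) + circle_avg (\<lambda>\<theta>. k * (F \<theta> * poisson_kernel z \<theta>))"
    by (intro circle_avg_add continuous_intros F z)
  also have "circle_avg (\<lambda>\<theta>. (y powr s - k * y) * poisson_kernel z \<theta>) = (y powr s - k * y) * 1"
    unfolding circle_avg_poisson_kernel[OF z, symmetric] by (intro circle_avg_mult_left continuous_intros z)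
  also have "circle_avg (\<lambda>\<theta>. k * (F \<theta> * poisson_kernel z \<theta>)) = k * y"
    unfolding y_def Re_herglotz[OF F(1) z] by (intro circle_avg_mult_left c)
  finally have "y powr s = circle_avg (\<lambda>\<theta>. (y powr s - k * y) * poisson_kernel z \<theta> + k * (F \<theta> * poisson_kernel z \<theta>))"
    by simp
  also have "\<dots> \<le> circle_avg (\<lambda>\<theta>. F \<theta> powr s * poisson_kernel z \<theta>)"
  proof (rule circle_avg_mono)
    fix \<theta> :: real assume t: "\<theta> \<in> {0..2*pi}"
    have "(y powr s + k * (F \<theta> - y)) * poisson_kernel z \<theta> \<le> F \<theta> powr s * poisson_kernel z \<theta>"
      using powr_tangent_le[OF s F(2)[OF t] y] poisson_kernel_pos[OF z, of \<theta>]
      by (intro mult_right_mono) (auto simp: k_def)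
    then show "(y powr s - k * y) * poisson_kernel z \<theta> + k * (F \<theta> * poisson_kernel z \<theta>) \<le> F \<theta> powr s * poisson_kernel z \<theta>"
      by (simp add: algebra_simps)
  qed (intro continuous_intros F Fs z)+
  finally show ?thesis unfolding Re_herglotz[OF Fs z] y_def .
qed

lemma tangent_slope_pos: "1 < q \<Longrightarrow> 0 < tangent_slope q"
  using tangency_angle[of q] by (simp add: tangent_slope_def)

lemma tangent_slope_le_1:
  assumes "1 < q"
  shows "tangent_slope q \<le> 1"
proof -
  have "cos (pi / (2 * q)) powr (q - 1) \<le> 1"
    using tangency_angle[OF assms] assms by (intro powr_le1) auto
  then have "cos (pi / (2 * q)) powr (q - 1) * sin (pi / (2 * q)) \<le> 1 * 1"
    using tangency_angle[OF assms] by (intro mult_mono) auto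
  then show ?thesis by (simp add: tangent_slope_def)
qed

text \<open>
Writing \<open>c = cos (pi / (2 * p))\<close> and \<open>d = cos (pi / (4 * p))\<close>, the claim reduces to
\<open>1 \<le> 2 * d\<^sup>2 * c powr (- p - 1)\<close>.  Both \<open>2 * d\<^sup>2 = 1 + c\<close> and the negative power of \<open>c\<close> are at
least 1.
\<close>

lemma tangent_slope_double_le:
  assumes p: "1 < p"
  shows "tangent_slope (2 * p) \<le> (cos (pi / (4 * p)) / cos (pi / (2 * p))) powr (2 * p) * tangent_slope p"
proof -
  define c where "c = cos (pi / (2 * p))"
  define d where "d = cos (pi / (4 * p))"
  define s where "s = sin (pi / (4 * p))"
  have c: "0 < c" "c \<le> 1" using tangency_angle[OF p] by (auto simp: c_def)
  have "1 < 2 * p" using p by simp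
  note h = tangency_angle[OF this]
  have d: "0 < d" and s: "0 < s" using h by (auto simp: d_def s_def)
  have half: "pi / (2 * p) = 2 * (pi / (4 * p))" by simp
  have dd: "2 * d\<^sup>2 = 1 + c" unfolding c_def d_def half cos_double_cos by simp
  have sn: "sin (pi / (2 * p)) = 2 * s * d" unfolding s_def d_def half sin_double by simp
  have cinv: "1 \<le> c powr (- p - 1)"
    using powr_mono'[of "- p - 1" 0 c] p c by simp
  have "tangent_slope (2 * p) = d powr (2 * p) * s / d"
    using d by (simp add: tangent_slope_def d_def s_def powr_diff)
  also have "\<dots> \<le> d powr (2 * p) * s / d * (2 * d\<^sup>2)"
  proof -
    have "d powr (2 * p) * s / d * 1 \<le> d powr (2 * p) * s / d * (2 * d\<^sup>2)"
      by (rule mult_left_mono) (use dd c d s in auto)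
    then show ?thesis by (simp only: mult_1_right)
  qed
  also have "\<dots> = d powr (2 * p) * (2 * s * d) * 1"
    using d by (simp add: power2_eq_square)
  also have "\<dots> \<le> d powr (2 * p) * (2 * s * d) * c powr (- p - 1)"
    using d s cinv by (intro mult_left_mono) auto
  also have "c powr (- p - 1) = c powr (p - 1) / c powr (2 * p)"
    using c by (simp flip: powr_diff)
  finally have "tangent_slope (2 * p) \<le> d powr (2 * p) / c powr (2 * p) * (c powr (p - 1) * (2 * s * d))"
    by (simp add: mult_ac)
  moreover have "tangent_slope p = c powr (p - 1) * (2 * s * d)"
    by (simp only: tangent_slope_def sn c_def)
  ultimately show ?thesis
    unfolding c_def[symmetric] d_def[symmetric] using c d by (simp only: powr_divide)
qed

text \<open>
Write \<open>g\<close> for the Herglotz integral, \<open>N\<close> for the mean of \<open>F powr p\<close> and \<open>a = g 0\<close>.  Averaging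
\<open>c powr p * norm g powr p + B * Re (g powr p) \<le> Re g powr p\<close> over circles bounds the means of
\<open>norm g powr p\<close> by \<open>M = (N - B * a powr p) / c powr p\<close>.  As \<open>g\<close> has no zero, \<open>G = g powr (p / 2)\<close> is
holomorphic, and Carleman's inequality for \<open>G\<close> controls the area integral of
\<open>norm g powr (2 * p)\<close> by \<open>pi * M\<^sup>2\<close>.  Passing from \<open>norm g powr (2 * p)\<close> to \<open>Re g powr (2 * p)\<close> gains the
factor \<open>d powr (2 * p)\<close> but costs the error term \<open>B' * a powr (2 * p)\<close>.  This loss is
compensated by the term \<open>- B * a powr p\<close> gained in \<open>M\<close>.
\<close>

lemma nn_integral_herglotz_powr_le_exponent_le_2:
  assumes p: "1 < p" "p \<le> 2"
    and F: "continuous_on {0..2*pi} F" "\<And>\<theta>. \<theta> \<in> {0..2*pi} \<Longrightarrow> 0 < F \<theta>"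
  shows "(\<integral>\<^sup>+z\<in>ball 0 1. ennreal (Re (herglotz F z) powr (2 * p)) \<partial>lborel)
     \<le> ennreal (pi * ((cos (pi / (4 * p)) / cos (pi / (2 * p))) powr (2 * p)
          * (circle_avg (\<lambda>\<theta>. F \<theta> powr p))\<^sup>2))"
proof -
  define g where "g = herglotz F"
  define N where "N = circle_avg (\<lambda>\<theta>. F \<theta> powr p)"
  define a where "a = circle_avg F"
  define c where "c = cos (pi / (2 * p))"
  define d where "d = cos (pi / (4 * p))"
  define B where "B = tangent_slope p"
  define B' where "B' = tangent_slope (2 * p)"
  define M where "M = (N - B * a powr p) / c powr p"
  have c: "0 < c" using tangency_angle[OF p(1)] by (simp add: c_def)
  have p2: "1 < 2 * p" using p by simp
  have d: "0 < d" using tangency_angle[OF p2] by (simp add: d_def)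
  have B: "0 < B" "B \<le> 1" using tangent_slope_pos tangent_slope_le_1 p by (auto simp: B_def)
  have B': "0 < B'" using tangent_slope_pos[OF p2] by (simp add: B'_def)
  have a: "0 < a" unfolding a_def by (rule circle_avg_pos[OF F])
  have Fp: "continuous_on {0..2*pi} (\<lambda>\<theta>. F \<theta> powr p)"
    using F by (intro continuous_intros) (auto simp: less_imp_neq[symmetric])
  have g: "g holomorphic_on ball 0 1" unfolding g_def by (rule holomorphic_herglotz[OF F(1)])
  have gpos: "0 < Re (g z)" if "norm z < 1" for z unfolding g_def by (rule Re_herglotz_pos[OF F that])
  have gnz: "g z \<notin> \<real>\<^sub>\<le>\<^sub>0" if "norm z < 1" for z
    using gpos[OF that] by (auto simp: complex_nonpos_Reals_iff)
  have g0: "g 0 = of_real a" unfolding g_def a_def by (rule herglotz_0[OF F(1)])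
  have pow: "(\<lambda>z. g z powr of_real s) holomorphic_on ball 0 1" for s
    using gnz by (intro holomorphic_intros g) auto
  have powmean: "circle_avg (\<lambda>\<theta>. Re (g (z * cis \<theta>) powr of_real s)) = a powr s" if "norm z < 1" for z s
  proof -
    have "circle_avg (\<lambda>\<theta>. Re (g (z * cis \<theta>) powr of_real s)) = Re (circle_avg (\<lambda>\<theta>. g (z * cis \<theta>) powr of_real s))"
      by (rule circle_avg_linear[OF _ bounded_linear_Re])
         (rule continuous_on_circle[OF holomorphic_on_imp_continuous_on[OF pow] that])
    also have "\<dots> = Re (g 0 powr of_real s)"
      by (subst holomorphic_mean_value_inside[OF pow that]) simp
    finally show ?thesis using a by (simp add: g0 powr_of_real)
  qed
  have cg: "continuous_on S (\<lambda>\<theta>. g (z * cis \<theta>))" if "norm z < 1" for S z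
    by (rule continuous_on_circle[OF holomorphic_on_imp_continuous_on[OF g] that])
  have cis_lt: "norm (z * cis \<theta>) < 1" if "norm z < 1" for z \<theta> using that by (simp add: norm_mult)
  have gnz0: "g (z * cis \<theta>) \<noteq> 0" if "norm z < 1" for z \<theta>
    using gpos[OF cis_lt[OF that], of \<theta>] by auto
  have cRe: "continuous_on {0..2*pi} (\<lambda>\<theta>. Re (g (z * cis \<theta>)) powr s)" if "norm z < 1" for z s
    using gpos[OF cis_lt[OF that]] by (intro continuous_intros cg that) (auto simp: less_imp_neq[symmetric])
  have cnorm: "continuous_on {0..2*pi} (\<lambda>\<theta>. norm (g (z * cis \<theta>)) powr s)" if "norm z < 1" for z s
    using gnz0[OF that] by (intro continuous_intros cg that) auto
  have cpow: "continuous_on {0..2*pi} (\<lambda>\<theta>. Re (g (z * cis \<theta>) powr of_real s))" if "norm z < 1" for z s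
    by (intro continuous_intros continuous_on_circle[OF holomorphic_on_imp_continuous_on[OF pow] that])
  have meanN: "circle_avg (\<lambda>\<theta>. Re (g (z * cis \<theta>)) powr p) \<le> N" if z: "norm z < 1" for z
  proof -
    let ?h = "herglotz (\<lambda>\<theta>. F \<theta> powr p)"
    have h: "?h holomorphic_on ball 0 1" by (rule holomorphic_herglotz[OF Fp])
    have ch: "continuous_on {0..2*pi} (\<lambda>\<theta>. ?h (z * cis \<theta>))"
      by (rule continuous_on_circle[OF holomorphic_on_imp_continuous_on[OF h] z])
    have "circle_avg (\<lambda>\<theta>. Re (g (z * cis \<theta>)) powr p) \<le> circle_avg (\<lambda>\<theta>. Re (?h (z * cis \<theta>)))"
      unfolding g_def
      by (intro circle_avg_mono cRe[unfolded g_def] z continuous_intros ch Poisson_Jensen F cis_lt)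
         (use p in auto)
    also have "\<dots> = Re (circle_avg (\<lambda>\<theta>. ?h (z * cis \<theta>)))"
      by (rule circle_avg_linear[OF ch bounded_linear_Re])
    also have "\<dots> = N"
      unfolding holomorphic_mean_value_inside[OF h z] herglotz_0[OF Fp] N_def by simp
    finally show ?thesis .
  qed
  have aN: "a powr p \<le> N" using meanN[of 0] a by (simp add: g0)
  have meanM: "circle_avg (\<lambda>\<theta>. norm (g (z * cis \<theta>)) powr p) \<le> M" if z: "norm z < 1" for z
  proof -
    have "c powr p * circle_avg (\<lambda>\<theta>. norm (g (z * cis \<theta>)) powr p) + B * a powr p
      = circle_avg (\<lambda>\<theta>. c powr p * norm (g (z * cis \<theta>)) powr p)
        + circle_avg (\<lambda>\<theta>. B * Re (g (z * cis \<theta>) powr of_real p))"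
      by (simp only: powmean[OF z, symmetric] circle_avg_mult_left[OF cnorm[OF z]] circle_avg_mult_left[OF cpow[OF z]])
    also have "\<dots> = circle_avg (\<lambda>\<theta>. c powr p * norm (g (z * cis \<theta>)) powr p + B * Re (g (z * cis \<theta>) powr of_real p))"
      by (intro circle_avg_add[symmetric] continuous_on_mult_left cnorm cpow z)
    also have "\<dots> \<le> circle_avg (\<lambda>\<theta>. Re (g (z * cis \<theta>)) powr p)"
      unfolding c_def B_def
      by (intro circle_avg_mono continuous_on_add continuous_on_mult_left cnorm cpow cRe z
          Re_powr_ge_right_half_plane p gpos cis_lt)
    also have "\<dots> \<le> N" by (rule meanN[OF z])
    finally show ?thesis using c by (simp add: M_def field_simps)
  qed
  have "(\<integral>\<^sup>+z\<in>ball 0 1. ennreal (Re (g z) powr (2 * p)) \<partial>lborel)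
     \<le> ennreal (pi * (d powr (2 * p) * M\<^sup>2 + B' * a powr (2 * p)))"
  proof (rule Carleman_inequality_majorant[OF pow[of "p / 2"]])
    fix z :: complex assume z: "norm z < 1"
    have n: "norm (g (z * cis \<theta>) powr of_real s) = norm (g (z * cis \<theta>)) powr s" for \<theta> s
      by (rule right_half_plane_powr[OF gpos[OF cis_lt[OF z]]])
    have n2: "(norm (g (z * cis \<theta>) powr of_real (p / 2)))\<^sup>2 = norm (g (z * cis \<theta>)) powr p" for \<theta>
      unfolding n by (simp add: power2_eq_square flip: powr_add)
    have n4: "norm (g (z * cis \<theta>) powr of_real (p / 2)) ^ 4 = norm (g (z * cis \<theta>)) powr (2 * p)" for \<theta>
      unfolding n by (simp add: power4_eq_xxxx flip: powr_add)
    show "circle_avg (\<lambda>\<theta>. (norm (g (z * cis \<theta>) powr of_real (p / 2)))\<^sup>2) \<le> M"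
      unfolding n2 by (rule meanM[OF z])
    have "circle_avg (\<lambda>\<theta>. Re (g (z * cis \<theta>)) powr (2 * p))
      \<le> circle_avg (\<lambda>\<theta>. d powr (2 * p) * norm (g (z * cis \<theta>)) powr (2 * p)
          + B' * Re (g (z * cis \<theta>) powr of_real (2 * p)))"
    proof (intro circle_avg_mono continuous_on_add continuous_on_mult_left cnorm cpow cRe z)
      fix \<theta>
      have e: "4 * p = 2 * (2 * p)" by simp
      show "Re (g (z * cis \<theta>)) powr (2 * p) \<le> d powr (2 * p) * norm (g (z * cis \<theta>)) powr (2 * p)
          + B' * Re (g (z * cis \<theta>) powr of_real (2 * p))"
        unfolding d_def B'_def e by (rule Re_powr_le_right_half_plane) (use p gpos[OF cis_lt[OF z]] in auto)
    qed
    also have "\<dots> = circle_avg (\<lambda>\<theta>. d powr (2 * p) * norm (g (z * cis \<theta>)) powr (2 * p))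
          + circle_avg (\<lambda>\<theta>. B' * Re (g (z * cis \<theta>) powr of_real (2 * p)))"
      by (intro circle_avg_add continuous_on_mult_left cnorm cpow z)
    also have "\<dots> = d powr (2 * p) * circle_avg (\<lambda>\<theta>. norm (g (z * cis \<theta>)) powr (2 * p)) + B' * a powr (2 * p)"
      by (simp only: powmean[OF z, symmetric] circle_avg_mult_left[OF cnorm[OF z]] circle_avg_mult_left[OF cpow[OF z]])
    finally show "circle_avg (\<lambda>\<theta>. Re (g (z * cis \<theta>)) powr (2 * p))
       \<le> d powr (2 * p) * circle_avg (\<lambda>\<theta>. norm (g (z * cis \<theta>) powr of_real (p / 2)) ^ 4) + B' * a powr (2 * p)"
      unfolding n4 .
  next
    show "continuous_on (ball 0 1) (\<lambda>z. Re (g z) powr (2 * p))"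
      using gpos by (intro continuous_intros holomorphic_on_imp_continuous_on g) (auto simp: less_imp_neq[symmetric])
  qed (use B' in auto)
  also have "\<dots> \<le> ennreal (pi * ((d / c) powr (2 * p) * N\<^sup>2))"
  proof (intro ennreal_leI mult_left_mono)
    define X where "X = a powr p"
    define K where "K = (d / c) powr (2 * p)"
    have X: "0 \<le> X" "X \<le> N" using aN by (auto simp: X_def)
    have K: "0 \<le> K" by (simp add: K_def)
    have sq: "y powr (2 * p) = (y powr p)\<^sup>2" for y :: real
      by (simp add: power2_eq_square flip: powr_add)
    have KM: "d powr (2 * p) * M\<^sup>2 = K * (N - B * X)\<^sup>2"
      using c d by (simp add: M_def K_def X_def sq power_divide powr_divide)
    have BX: "B * X \<le> X" using B X by (simp add: mult_left_le_one_le)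
    \<comment> \<open>The loss \<open>B' * X\<^sup>2\<close> is absorbed by \<open>K * N\<^sup>2 - K * (N - B * X)\<^sup>2\<close>; this uses \<open>X \<le> N\<close>, which
        is Jensen's inequality at the origin, and \<open>B \<le> 1\<close>.\<close>
    have "B' * X\<^sup>2 \<le> K * B * X\<^sup>2"
      using tangent_slope_double_le[OF p(1)] by (intro mult_right_mono) (auto simp: B'_def K_def B_def c_def d_def)
    also have "\<dots> = K * (B * X * X)" by (simp add: power2_eq_square)
    also have "\<dots> \<le> K * (B * X * (2 * N - B * X))"
      using K B X BX by (intro mult_left_mono) auto
    also have "\<dots> = K * N\<^sup>2 - K * (N - B * X)\<^sup>2" by (simp add: power2_eq_square algebra_simps)
    finally have "K * (N - B * X)\<^sup>2 + B' * X\<^sup>2 \<le> K * N\<^sup>2" by simp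
    then show "d powr (2 * p) * M\<^sup>2 + B' * a powr (2 * p) \<le> (d / c) powr (2 * p) * N\<^sup>2"
      unfolding KM sq[of a] K_def X_def .
  qed simp
  finally show ?thesis unfolding g_def N_def c_def d_def .
qed

text \<open>
By the double angle formulas \<open>1 - \<bar>cos (pi / p)\<bar>\<close> is twice the square of \<open>cos (pi / (2 * p))\<close> or of
\<open>sin (pi / (2 * p))\<close>, according to the sign of \<open>cos (pi / p)\<close>.
\<close>

lemma isoperimetric_constant_eq:
  assumes p: "1 < p"
  shows "p \<le> 2 \<Longrightarrow> sqrt 2 * cos (pi / (4 * p)) / sqrt (1 - \<bar>cos (pi / p)\<bar>) = cos (pi / (4 * p)) / cos (pi / (2 * p))"
    and "2 \<le> p \<Longrightarrow> sqrt 2 * cos (pi / (4 * p)) / sqrt (1 - \<bar>cos (pi / p)\<bar>) = 1 / (2 * sin (pi / (4 * p)))"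
proof -
  have "1 < 2 * p" using p by simp
  note h = tangency_angle[OF p] tangency_angle[OF this]
  have dbl: "pi / p = 2 * (pi / (2 * p))" "pi / (2 * p) = 2 * (pi / (4 * p))" by auto
  show "sqrt 2 * cos (pi / (4 * p)) / sqrt (1 - \<bar>cos (pi / p)\<bar>) = cos (pi / (4 * p)) / cos (pi / (2 * p))" if "p \<le> 2"
  proof -
    have "cos (pi / p) \<le> 0"
      using p that cos_monotone_0_pi_le[of "pi / 2" "pi / p"] by (simp add: field_simps)
    then have "1 - \<bar>cos (pi / p)\<bar> = 2 * (cos (pi / (2 * p)))\<^sup>2"
      unfolding dbl(1) cos_double_cos by simp
    then show ?thesis using h by (simp add: real_sqrt_mult)
  qed
  show "sqrt 2 * cos (pi / (4 * p)) / sqrt (1 - \<bar>cos (pi / p)\<bar>) = 1 / (2 * sin (pi / (4 * p)))" if "2 \<le> p"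
  proof -
    have "0 \<le> cos (pi / p)"
    proof (rule cos_ge_zero)
      have "0 \<le> pi / p" "pi / p \<le> pi / 2" using that by (auto simp: field_simps)
      then show "- (pi / 2) \<le> pi / p" "pi / p \<le> pi / 2" using pi_gt_zero by linarith+
    qed
    then have e: "1 - \<bar>cos (pi / p)\<bar> = 2 * (sin (pi / (2 * p)))\<^sup>2"
      unfolding dbl(1) cos_double_sin by simp
    have "sin (pi / (2 * p)) = 2 * sin (pi / (4 * p)) * cos (pi / (4 * p))"
      unfolding dbl(2) sin_double by simp
    then show ?thesis unfolding e using h by (simp add: real_sqrt_mult)
  qed
qed

text \<open>
For \<open>p > 2\<close> Jensen's inequality bounds the power \<open>p / 2\<close> of the Poisson integral of \<open>F\<close> by the
Poisson integral of \<open>F powr (p / 2)\<close>, and the case \<open>p = 2\<close> applies to the latter.  This suffices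
since the constant is at least 1 at \<open>p = 2\<close> and increases from there on.
\<close>

lemma nn_integral_herglotz_powr_le:
  assumes p: "1 < p"
    and F: "continuous_on {0..2*pi} F" "\<And>\<theta>. \<theta> \<in> {0..2*pi} \<Longrightarrow> 0 < F \<theta>"
  shows "(\<integral>\<^sup>+z\<in>ball 0 1. ennreal (Re (herglotz F z) powr (2 * p)) \<partial>lborel)
     \<le> ennreal (pi * ((sqrt 2 * cos (pi / (4 * p)) / sqrt (1 - \<bar>cos (pi / p)\<bar>)) powr (2 * p)
          * (circle_avg (\<lambda>\<theta>. F \<theta> powr p))\<^sup>2))"
proof (cases "p \<le> 2")
  case True
  then show ?thesis
    using nn_integral_herglotz_powr_le_exponent_le_2[OF p True F] unfolding isoperimetric_constant_eq(1)[OF p True] by simp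
next
  case False
  then have p2: "2 \<le> p" by simp
  define s where "s = p / 2"
  define H where "H = (\<lambda>\<theta>. F \<theta> powr s)"
  have H: "continuous_on {0..2*pi} H" "\<And>\<theta>. \<theta> \<in> {0..2*pi} \<Longrightarrow> 0 < H \<theta>"
    unfolding H_def using F(2) by (auto intro!: continuous_intros F(1) simp: less_imp_neq[symmetric])
  define C where "C = (\<lambda>p. 1 / (2 * sin (pi / (4 * p))))"
  have "(\<integral>\<^sup>+z\<in>ball 0 1. ennreal (Re (herglotz F z) powr (2 * p)) \<partial>lborel)
     \<le> (\<integral>\<^sup>+z\<in>ball 0 1. ennreal (Re (herglotz H z) powr (2 * 2)) \<partial>lborel)"
  proof (rule nn_integral_mono)
    fix z :: complex
    show "ennreal (Re (herglotz F z) powr (2 * p)) * indicator (ball 0 1) z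
       \<le> ennreal (Re (herglotz H z) powr (2 * 2)) * indicator (ball 0 1) z"
    proof (cases "norm z < 1")
      case z: True
      have "Re (herglotz F z) powr (2 * p) = (Re (herglotz F z) powr s) powr (2 * 2)"
        by (simp add: s_def powr_powr)
      also have "\<dots> \<le> Re (herglotz H z) powr (2 * 2)"
        using Poisson_Jensen[OF F _ z, of s] p2 by (intro powr_mono2) (auto simp: H_def s_def)
      finally show ?thesis using z by (simp add: ennreal_leI)
    qed simp
  qed
  also have "\<dots> \<le> ennreal (pi * (C 2 powr (2 * 2) * (circle_avg (\<lambda>\<theta>. H \<theta> powr 2))\<^sup>2))"
    using nn_integral_herglotz_powr_le_exponent_le_2[of 2 H] H isoperimetric_constant_eq[of 2] by (simp add: C_def)
  also have "(\<lambda>\<theta>. H \<theta> powr 2) = (\<lambda>\<theta>. F \<theta> powr p)"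
    by (simp add: H_def s_def powr_powr fun_eq_iff)
  also have "ennreal (pi * (C 2 powr (2 * 2) * (circle_avg (\<lambda>\<theta>. F \<theta> powr p))\<^sup>2))
     \<le> ennreal (pi * (C p powr (2 * p) * (circle_avg (\<lambda>\<theta>. F \<theta> powr p))\<^sup>2))"
  proof (intro ennreal_leI mult_left_mono mult_right_mono)
    have s8: "0 < sin (pi / 8)" by (intro sin_gt_zero) auto
    have "sin (pi / 8) \<le> sin (pi / 6)" by (intro sin_monotone_2pi_le) auto
    then have C2: "1 \<le> C 2" using s8 by (simp add: C_def sin_30 field_simps)
    have "sin (pi / (4 * p)) \<le> sin (pi / 8)"
    proof (rule sin_monotone_2pi_le)
      have "0 \<le> pi / (4 * p)" using p by simp
      then show "- (pi / 2) \<le> pi / (4 * p)" using pi_gt_zero by linarith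
      show "pi / (4 * p) \<le> pi / 8" using p2 by (simp add: field_simps)
    qed simp
    moreover have "0 < sin (pi / (4 * p))" using tangency_angle[of "2 * p"] p by simp
    ultimately have "C 2 \<le> C p" by (simp add: C_def frac_le)
    have "C 2 powr (2 * 2) \<le> C 2 powr (2 * p)" using C2 p2 by (intro powr_mono) auto
    also have "\<dots> \<le> C p powr (2 * p)" using C2 \<open>C 2 \<le> C p\<close> p by (intro powr_mono2) auto
    finally show "C 2 powr (2 * 2) \<le> C p powr (2 * p)" .
  qed auto
  finally show ?thesis unfolding isoperimetric_constant_eq(2)[OF p p2] C_def .
qed

section \<open>The isoperimetric inequality\<close>

lemma circle_mean_eq_circle_avg:
  assumes f: "continuous_on (ball 0 1) f" and r: "0 < r" "r < 1" and p: "0 < p"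
  shows "circle_mean p f r = circle_avg (\<lambda>\<theta>. norm (f (of_real r * cis \<theta>)) powr p) powr (1 / p)"
proof -
  have c: "continuous_on {0..2*pi} (\<lambda>\<theta>. norm (f (of_real r * cis \<theta>)) powr p)"
    by (intro continuous_on_powr' continuous_intros continuous_on_circle[OF f]) (use r p in auto)
  have "(LBINT \<theta>:{0..2 * pi}. norm (f (of_real r * cis \<theta>)) powr p)
     = integral {0..2 * pi} (\<lambda>\<theta>. norm (f (of_real r * cis \<theta>)) powr p)"
    by (intro set_borel_integral_eq_integral borel_integrable_atLeastAtMost' c)
  then show ?thesis
    by (simp add: circle_mean_def circle_avg_def cis_conv_exp)
qed

lemma harmonic_continuous_on:
  fixes f :: "complex \<Rightarrow> complex"
  assumes "harmonic_on f S" "convex S"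
  shows "continuous_on S f"
proof -
  obtain g h where gh: "g holomorphic_on S" "h holomorphic_on S"
    "\<And>z. z \<in> S \<Longrightarrow> f z = g z + cnj (h z)"
    using harmonic_decomposition[OF assms] by blast
  have "continuous_on S (\<lambda>z. g z + cnj (h z))"
    by (intro continuous_on_add continuous_on_cnj holomorphic_on_imp_continuous_on gh)
  then show ?thesis by (rule continuous_on_eq) (simp add: gh(3))
qed

text \<open>
A dilated harmonic function is the Poisson integral of its continuous boundary values, so it is
dominated by the Poisson integral of their modulus.  Adding \<open>\<epsilon>\<close> to the modulus makes it positive, as
needed for powers of the Herglotz integral, and \<open>\<epsilon>\<close> tends to 0 at the end.
\<close>

lemma nn_integral_dilated_harmonic_le:
  fixes f :: "complex \<Rightarrow> complex"
  assumes p: "1 < p" and f: "harmonic_on f (ball 0 1)" and R: "0 < R" "R < 1"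
  shows "(\<integral>\<^sup>+z\<in>ball 0 1. ennreal (norm (f (of_real R * z)) powr (2 * p)) \<partial>lborel)
     \<le> ennreal (pi * ((sqrt 2 * cos (pi / (4 * p)) / sqrt (1 - \<bar>cos (pi / p)\<bar>)) powr (2 * p)
          * (circle_avg (\<lambda>\<theta>. norm (f (of_real R * cis \<theta>)) powr p))\<^sup>2))"
proof -
  obtain g h where gh: "g holomorphic_on ball 0 1" "h holomorphic_on ball 0 1"
    "\<And>z. z \<in> ball 0 1 \<Longrightarrow> f z = g z + cnj (h z)"
    using harmonic_decomposition[OF f convex_ball] by blast
  define u where "u = (\<lambda>\<theta>. f (of_real R * cis \<theta>))"
  define F where "F = (\<lambda>\<epsilon> \<theta>. norm (u \<theta>) + \<epsilon>)"
  define K where "K = (sqrt 2 * cos (pi / (4 * p)) / sqrt (1 - \<bar>cos (pi / p)\<bar>)) powr (2 * p)"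
  let ?I = "\<integral>\<^sup>+z\<in>ball 0 1. ennreal (norm (f (of_real R * z)) powr (2 * p)) \<partial>lborel"
  have Rz: "norm (of_real R * z) < 1" if "norm z \<le> 1" for z :: complex
  proof -
    have "R * norm z \<le> R * 1" by (rule mult_left_mono) (use R that in auto)
    also have "\<dots> < 1" using R by simp
    finally show ?thesis using R by (simp add: norm_mult)
  qed
  have dil: "(\<lambda>w. k (of_real R * w)) holomorphic_on cball 0 1" if "k holomorphic_on ball 0 1" for k
  proof -
    have "(\<lambda>w. of_real R * w) ` cball 0 1 \<subseteq> ball (0::complex) 1" using Rz by auto
    then have "(k \<circ> (\<lambda>w. of_real R * w)) holomorphic_on cball 0 1"
      by (intro holomorphic_on_compose_gen[OF _ that] holomorphic_intros)
    then show ?thesis by (simp add: o_def)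
  qed
  note dil' = holomorphic_on_imp_continuous_on[OF dil] holomorphic_on_subset[OF dil ball_subset_cball]
  have cf: "continuous_on (ball 0 1) f" by (rule harmonic_continuous_on[OF f convex_ball])
  have cu: "continuous_on S u" for S
    unfolding u_def by (rule continuous_on_circle[OF cf]) (use R in simp)
  have dom: "norm (f (of_real R * z)) \<le> Re (herglotz (F \<epsilon>) z)" if "0 < \<epsilon>" and z: "norm z < 1" for \<epsilon> z
  proof -
    have cF: "continuous_on {0..2*pi} (F \<epsilon>)" unfolding F_def by (intro continuous_intros cu)
    have "f (of_real R * z) = circle_avg (\<lambda>\<theta>. (g (of_real R * cis \<theta>) + cnj (h (of_real R * cis \<theta>))) * poisson_kernel z \<theta>)"
      using Poisson_formula_harmonic[OF dil'[OF gh(1)] dil'[OF gh(2)] z] gh(3)[of "of_real R * z"] Rz[of z] z by simp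
    also have "\<dots> = circle_avg (\<lambda>\<theta>. u \<theta> * poisson_kernel z \<theta>)"
      by (intro circle_avg_cong) (use gh(3) Rz in \<open>simp add: u_def\<close>)
    finally have "norm (f (of_real R * z)) = norm (circle_avg (\<lambda>\<theta>. u \<theta> * poisson_kernel z \<theta>))" by simp
    also have "\<dots> \<le> circle_avg (\<lambda>\<theta>. F \<epsilon> \<theta> * poisson_kernel z \<theta>)"
    proof (intro norm_circle_avg_le continuous_intros cu cF z)
      fix \<theta>
      have "norm (u \<theta>) * poisson_kernel z \<theta> \<le> F \<epsilon> \<theta> * poisson_kernel z \<theta>"
        using that poisson_kernel_pos[OF z, of \<theta>] by (intro mult_right_mono) (auto simp: F_def)
      then show "norm (u \<theta> * complex_of_real (poisson_kernel z \<theta>)) \<le> F \<epsilon> \<theta> * poisson_kernel z \<theta>"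
        using poisson_kernel_pos[OF z, of \<theta>] by (simp add: norm_mult)
    qed
    also have "\<dots> = Re (herglotz (F \<epsilon>) z)" by (rule Re_herglotz[OF cF z, symmetric])
    finally show ?thesis .
  qed
  have bound: "?I \<le> ennreal (pi * (K * (circle_avg (\<lambda>\<theta>. F \<epsilon> \<theta> powr p))\<^sup>2))" if "0 < \<epsilon>" for \<epsilon>
  proof -
    have "?I \<le> (\<integral>\<^sup>+z\<in>ball 0 1. ennreal (Re (herglotz (F \<epsilon>) z) powr (2 * p)) \<partial>lborel)"
    proof (rule nn_integral_mono)
      fix z :: complex
      show "ennreal (norm (f (of_real R * z)) powr (2 * p)) * indicator (ball 0 1) z
         \<le> ennreal (Re (herglotz (F \<epsilon>) z) powr (2 * p)) * indicator (ball 0 1) z"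
        using dom[OF that, of z] p by (cases "norm z < 1") (auto intro!: ennreal_leI powr_mono2)
    qed
    also have "\<dots> \<le> ennreal (pi * (K * (circle_avg (\<lambda>\<theta>. F \<epsilon> \<theta> powr p))\<^sup>2))"
      unfolding K_def
    proof (rule nn_integral_herglotz_powr_le[OF p])
      show "continuous_on {0..2*pi} (F \<epsilon>)" unfolding F_def by (intro continuous_intros cu)
      show "0 < F \<epsilon> \<theta>" for \<theta> using that by (simp add: F_def add_nonneg_pos)
    qed
    finally show ?thesis .
  qed
  have "continuous_on {0..1} (\<lambda>\<epsilon>. integral (cbox 0 (2*pi)) (\<lambda>\<theta>. F \<epsilon> \<theta> powr p))"
  proof (rule integral_continuous_on_param)
    have "continuous_on ({0..1} \<times> cbox 0 (2*pi)) (\<lambda>x. u (snd x))"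
      by (rule continuous_on_compose2[OF cu[of UNIV]]) (auto intro!: continuous_intros)
    then show "continuous_on ({0..1} \<times> cbox 0 (2*pi)) (\<lambda>(\<epsilon>, \<theta>). F \<epsilon> \<theta> powr p)"
      unfolding case_prod_beta F_def
      by (intro continuous_on_powr' continuous_intros) (use p in \<open>auto\<close>)
  qed
  then have "((\<lambda>\<epsilon>. integral {0..2*pi} (\<lambda>\<theta>. F \<epsilon> \<theta> powr p)) \<longlongrightarrow> integral {0..2*pi} (\<lambda>\<theta>. F 0 \<theta> powr p)) (at_right 0)"
    by (auto simp: continuous_on at_within_Icc_at_right[symmetric, of 0 1])
  then have "((\<lambda>\<epsilon>. ennreal (pi * (K * (circle_avg (\<lambda>\<theta>. F \<epsilon> \<theta> powr p))\<^sup>2)))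
       \<longlongrightarrow> ennreal (pi * (K * (circle_avg (\<lambda>\<theta>. F 0 \<theta> powr p))\<^sup>2))) (at_right 0)"
    unfolding circle_avg_def by (intro tendsto_intros)
  then have "?I \<le> ennreal (pi * (K * (circle_avg (\<lambda>\<theta>. F 0 \<theta> powr p))\<^sup>2))"
  proof (rule tendsto_lowerbound)
    show "\<forall>\<^sub>F \<epsilon> in at_right 0. ?I \<le> ennreal (pi * (K * (circle_avg (\<lambda>\<theta>. F \<epsilon> \<theta> powr p))\<^sup>2))"
      using eventually_at_right_less[of 0] by eventually_elim (rule bound)
  qed simp
  then show ?thesis by (simp add: F_def u_def K_def)
qed

text \<open>
The estimate for dilations is uniform in the radius \<open>R n\<close>.  Fatou's lemma lets \<open>R n\<close> tend to 1 and
yields integrability together with the bound.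
\<close>

theorem corollary5p3:
  fixes p :: real and f :: "complex \<Rightarrow> complex"
  assumes "p > 1" and "f \<in> harmonic_hardy p"
  shows "f \<in> harmonic_bergman (2 * p) \<and>
    bergman_norm (2 * p) f
      \<le> sqrt 2 * cos (pi / (4 * p)) / sqrt (1 - \<bar>cos (pi / p)\<bar>) * hardy_norm p f"
proof -
  define C where "C = sqrt 2 * cos (pi / (4 * p)) / sqrt (1 - \<bar>cos (pi / p)\<bar>)"
  define N where "N = hardy_norm p f"
  have p: "1 < p" "0 < p" using assms by auto
  have f: "harmonic_on f (ball 0 1)" and bdd: "bdd_above (circle_mean p f ` {0<..<1})"
    using assms by (auto simp: harmonic_hardy_def)
  have cf: "continuous_on (ball 0 1) f" by (rule harmonic_continuous_on[OF f convex_ball])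
  have C: "0 \<le> C"
    unfolding C_def using tangency_angle[of "2 * p"] p by (intro divide_nonneg_nonneg mult_nonneg_nonneg) auto
  have mean_le: "circle_mean p f r \<le> N" if "0 < r" "r < 1" for r
    unfolding N_def hardy_norm_def using that by (intro cSUP_upper bdd) auto
  have N: "0 \<le> N"
    by (rule order_trans[OF _ mean_le[of "1/2"]]) (auto simp: circle_mean_def)
  have avg_le: "(circle_avg (\<lambda>\<theta>. norm (f (of_real r * cis \<theta>)) powr p))\<^sup>2 \<le> N powr (2 * p)"
    if "0 < r" "r < 1" for r
  proof -
    let ?A = "circle_avg (\<lambda>\<theta>. norm (f (of_real r * cis \<theta>)) powr p)"
    have "continuous_on {0..2*pi} (\<lambda>\<theta>. norm (f (of_real r * cis \<theta>)) powr p)"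
      by (intro continuous_on_powr' continuous_intros continuous_on_circle[OF cf]) (use that p in auto)
    then have "circle_avg (\<lambda>\<theta>. 0) \<le> ?A" by (intro circle_avg_mono) auto
    then have A: "0 \<le> ?A" by simp
    have "?A = (?A powr (1 / p)) powr p" using A p by (simp add: powr_powr)
    also have "\<dots> \<le> N powr p"
      using mean_le[OF that] circle_mean_eq_circle_avg[OF cf that p(2)] p by (intro powr_mono2) auto
    finally have "?A\<^sup>2 \<le> (N powr p)\<^sup>2" using A by (intro power_mono) auto
    also have "\<dots> = N powr (2 * p)" by (simp add: power2_eq_square flip: powr_add)
    finally show ?thesis .
  qed
  define R where "R = (\<lambda>n. real (Suc n) / real (Suc (Suc n)))"
  have R: "0 < R n" "R n < 1" for n by (auto simp: R_def)
  have R1: "R \<longlonglongrightarrow> 1"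
    unfolding R_def using LIMSEQ_Suc[OF LIMSEQ_n_over_Suc_n] by simp
  define v where "v = (\<lambda>n z. ennreal (indicator (ball 0 1) z * norm (f (of_real (R n) * z)) powr (2 * p)))"
  have v: "v n \<in> borel_measurable lborel" for n
  proof -
    have c: "continuous_on (ball 0 1) (\<lambda>z. norm (f (of_real (R n) * z)) powr (2 * p))"
    proof (intro continuous_on_powr' continuous_intros continuous_on_compose2[OF cf])
      show "(*) (complex_of_real (R n)) ` ball 0 1 \<subseteq> ball 0 1"
      proof clarsimp
        fix z :: complex assume "norm z < 1"
        then have "R n * norm z \<le> 1 * norm z" using R[of n] by (intro mult_right_mono) auto
        then show "norm (complex_of_real (R n) * z) < 1" using \<open>norm z < 1\<close> R[of n] by (simp add: norm_mult)
      qed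
    qed (use p in auto)
    show ?thesis
      unfolding v_def using borel_measurable_continuous_on_indicator[OF _ c] by simp
  qed
  define w where "w = (\<lambda>z. indicator (ball 0 1) z * norm (f z) powr (2 * p))"
  have wm: "w \<in> borel_measurable lborel"
  proof -
    have c: "continuous_on (ball 0 1) (\<lambda>z. norm (f z) powr (2 * p))"
      by (intro continuous_on_powr' continuous_intros cf) (use p in auto)
    show ?thesis
      unfolding w_def using borel_measurable_continuous_on_indicator[OF _ c] by simp
  qed
  have lim: "(\<lambda>n. v n z) \<longlonglongrightarrow> ennreal (w z)" for z
  proof (cases "z \<in> ball 0 1")
    case True
    have "isCont f z" using cf True by (simp add: continuous_on_eq_continuous_at)
    moreover have "(\<lambda>n. of_real (R n) * z) \<longlonglongrightarrow> z"
      using tendsto_mult[OF tendsto_of_real[OF R1] tendsto_const[of z]] by simp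
    ultimately have "(\<lambda>n. f (of_real (R n) * z)) \<longlonglongrightarrow> f z"
      using isCont_tendsto_compose by blast
    then have "(\<lambda>n. norm (f (of_real (R n) * z)) powr (2 * p)) \<longlonglongrightarrow> norm (f z) powr (2 * p)"
      by (intro tendsto_powr' tendsto_norm tendsto_const) (use p in auto)
    then show ?thesis using True unfolding v_def w_def by (intro tendsto_ennrealI) simp
  qed (simp add: v_def w_def)
  have vle: "(\<integral>\<^sup>+z. v n z \<partial>lborel) \<le> ennreal (pi * (C * N) powr (2 * p))" for n
  proof -
    have "(\<integral>\<^sup>+z. v n z \<partial>lborel) = (\<integral>\<^sup>+z\<in>ball 0 1. ennreal (norm (f (of_real (R n) * z)) powr (2 * p)) \<partial>lborel)"
      unfolding v_def by (intro nn_integral_cong) (simp add: indicator_def)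
    also have "\<dots> \<le> ennreal (pi * (C powr (2 * p) * (circle_avg (\<lambda>\<theta>. norm (f (of_real (R n) * cis \<theta>)) powr p))\<^sup>2))"
      unfolding C_def by (rule nn_integral_dilated_harmonic_le[OF p(1) f R])
    also have "\<dots> \<le> ennreal (pi * (C powr (2 * p) * N powr (2 * p)))"
      by (intro ennreal_leI mult_left_mono avg_le R) auto
    finally show ?thesis using C N by (simp add: powr_mult)
  qed
  have "(\<integral>\<^sup>+z. ennreal (w z) \<partial>lborel) = (\<integral>\<^sup>+z. liminf (\<lambda>n. v n z) \<partial>lborel)"
    using lim_imp_Liminf[OF _ lim] by (intro nn_integral_cong) simp
  also have "\<dots> \<le> liminf (\<lambda>n. \<integral>\<^sup>+z. v n z \<partial>lborel)" by (rule nn_integral_liminf[OF v])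
  also have "\<dots> \<le> liminf (\<lambda>n::nat. ennreal (pi * (C * N) powr (2 * p)))"
    by (intro Liminf_mono always_eventually allI vle)
  also have "\<dots> = ennreal (pi * (C * N) powr (2 * p))" by (intro Liminf_const) simp
  finally have wle: "(\<integral>\<^sup>+z. ennreal (w z) \<partial>lborel) \<le> ennreal (pi * (C * N) powr (2 * p))" .
  have w0: "0 \<le> w z" for z by (simp add: w_def)
  have int: "integrable lborel w"
  proof (rule integrableI_nonneg[OF wm])
    show "(\<integral>\<^sup>+z. ennreal (w z) \<partial>lborel) < \<infinity>" using wle by (rule le_less_trans) simp
  qed (simp add: w0)
  have mem: "f \<in> harmonic_bergman (2 * p)"
    using f int by (simp add: harmonic_bergman_def set_integrable_def w_def)
  have "ennreal (integral\<^sup>L lborel w) \<le> ennreal (pi * (C * N) powr (2 * p))"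
    using wle nn_integral_eq_integral[OF int] w0 by simp
  then have "integral\<^sup>L lborel w \<le> pi * (C * N) powr (2 * p)"
    by (subst (asm) ennreal_le_iff) auto
  then have "integral\<^sup>L lborel w / pi \<le> (C * N) powr (2 * p)"
    by (simp add: divide_le_eq mult.commute)
  moreover have "0 \<le> integral\<^sup>L lborel w" by (intro Bochner_Integration.integral_nonneg w0)
  ultimately have "(integral\<^sup>L lborel w / pi) powr (1 / (2 * p)) \<le> ((C * N) powr (2 * p)) powr (1 / (2 * p))"
    using p by (intro powr_mono2) auto
  also have "\<dots> = C * N" using C N p by (simp add: powr_powr)
  finally have "bergman_norm (2 * p) f \<le> C * N"
    by (simp add: bergman_norm_def set_lebesgue_integral_def w_def)
  then show ?thesis using mem unfolding C_def N_def by blast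
qed

end
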